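(* Let $k$ be a field, $n\ge 1$, $\mathcal{A}=\mathcal{NC}_n$ the Nilcoxeter algebra over $k$, and $\pi:\mathcal{A}\to\mathcal{A}/[\mathcal{A},\mathcal{A}]_t$ the quotient map onto the quotient by the twisted commutator subspace. Let $\mathcal{B}=\{\pi(T_w): w\in S_n,\ \pi(T_w)\neq 0\}$ be the set of distinct nonzero images of the basis elements $T_w$. For $c\in\mathcal{B}$ put $$z_c=\sum_{w\in S_n,\ \pi(T_w)=c} T_{w^{-1}w_0},$$ where $w_0$ is the longest element of $S_n$ (so $T_{w^{-1}w_0}$ is the unique basis element complementary to $T_w$, i.e. $T_wT_{w^{-1}w_0}=T_{w_0}$). Then $\{z_c\}_{c\in\mathcal{B}}$ is a $k$-basis of the center $Z(\mathcal{NC}_n)$, and each $z_c$ is homogeneous with respect to the grading of $\mathcal{NC}_n$ in which $T_w$ has degree $l(w)$.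
   Context: The Nilcoxeter algebra $\mathcal{NC}_n$ is the unital associative $k$-algebra generated by $T_1,\dots,T_{n-1}$ with relations $T_iT_{i+1}T_i=T_{i+1}T_iT_{i+1}$, $T_iT_j=T_jT_i$ for $|i-j|>1$, and $T_i^2=0$. It has a $k$-basis $\{T_w\}_{w\in S_n}$, where $T_w=T_{i_1}\cdots T_{i_l}$ for any reduced expression $w=s_{i_1}\cdots s_{i_l}$, $s_i=(i\;\,i+1)$; $l$ is the Coxeter length on $S_n$. Let $f:\mathcal{A}\to\mathcal{A}$ be the algebra involution with $f(T_i)=T_{n-i}$ for $1\le i\le n-1$. The twisted commutator subspace $[\mathcal{A},\mathcal{A}]_t$ is the $k$-linear span of all elements $ab-bf(a)$, $a,b\in\mathcal{A}$. *)

theory Defs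
  imports
    Complex_Main
    "HOL-Library.Cardinality"
    "HOL-Library.Poly_Mapping"
    "HOL-Combinatorics.Permutations"
begin

section \<open>The symmetric group as a Coxeter group\<close>

text \<open>
  \<open>S\<^sub>n\<close> is the set of all \<open>w\<close> with \<open>w permutes {1..n}\<close>, multiplied by composition. A list
  \<open>[i\<^sub>1, \<dots>, i\<^sub>l]\<close> over \<open>{1..<n}\<close> stands for the expression \<open>s\<^bsub>i\<^sub>1\<^esub> \<circ> \<dots> \<circ> s\<^bsub>i\<^sub>l\<^esub>\<close>.
\<close>

definition perm_of :: "nat list \<Rightarrow> nat \<Rightarrow> nat" where
  "perm_of xs = foldr (\<lambda>i p. transpose i (i + 1) \<circ> p) xs id"

definition expresses :: "nat \<Rightarrow> nat list \<Rightarrow> (nat \<Rightarrow> nat) \<Rightarrow> bool" where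
  "expresses n xs w \<longleftrightarrow> set xs \<subseteq> {1..<n} \<and> perm_of xs = w"

definition cox_length :: "nat \<Rightarrow> (nat \<Rightarrow> nat) \<Rightarrow> nat" where
  "cox_length n w = (LEAST l. \<exists>xs. expresses n xs w \<and> length xs = l)"

definition reduced_expr :: "nat \<Rightarrow> nat list \<Rightarrow> (nat \<Rightarrow> nat) \<Rightarrow> bool" where
  "reduced_expr n xs w \<longleftrightarrow> expresses n xs w \<and> length xs = cox_length n w"

definition longest_perm :: "nat \<Rightarrow> nat \<Rightarrow> nat" where
  "longest_perm n = (ARG_MAX (cox_length n) w. w permutes {1..n})"


section \<open>The free algebra\<close>

text \<open>
  The free monoid on the letters \<open>1, \<dots>, n - 1\<close>, where \<open>n = CARD('n)\<close>. Concatenation is written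
  additively because \<^theory>\<open>HOL-Library.Poly_Mapping\<close> forms the monoid algebra
  \<open>'m \<Rightarrow>\<^sub>0 'k\<close> of a (not necessarily commutative) monoid \<open>'m\<close> of class \<^class>\<open>monoid_add\<close>.
\<close>

typedef (overloaded) ('n::finite) gen_word = "{xs :: nat list. set xs \<subseteq> {1..<CARD('n)}}"
  by (rule exI[of _ "[]"]) simp

setup_lifting type_definition_gen_word

instantiation gen_word :: (finite) monoid_add
begin

lift_definition zero_gen_word :: "'a gen_word" is "[]" by simp

lift_definition plus_gen_word :: "'a gen_word \<Rightarrow> 'a gen_word \<Rightarrow> 'a gen_word" is "(@)" by simp

instance by standard (transfer; simp)+

end

type_synonym ('k, 'n) free_alg = "'n gen_word \<Rightarrow>\<^sub>0 'k"

text \<open>Unspecified, and never used, for letters \<open>i\<close> outside \<open>{1..<CARD('n)}\<close>.\<close>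

definition free_gen :: "nat \<Rightarrow> ('k::field, 'n::finite) free_alg" where
  "free_gen i = Poly_Mapping.single (Abs_gen_word [i]) 1"

inductive_set nc_relators :: "('k::field, 'n::finite) free_alg set" where
  braid: "1 \<le> i \<Longrightarrow> i + 1 < CARD('n) \<Longrightarrow>
    (free_gen i * free_gen (i + 1) * free_gen i
      - free_gen (i + 1) * free_gen i * free_gen (i + 1) :: ('k, 'n) free_alg) \<in> nc_relators"
| commute: "i \<in> {1..<CARD('n)} \<Longrightarrow> j \<in> {1..<CARD('n)} \<Longrightarrow> \<bar>int i - int j\<bar> > 1 \<Longrightarrow>
    (free_gen i * free_gen j - free_gen j * free_gen i :: ('k, 'n) free_alg) \<in> nc_relators"
| nil: "i \<in> {1..<CARD('n)} \<Longrightarrow>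
    (free_gen i ^ 2 :: ('k, 'n) free_alg) \<in> nc_relators"

text \<open>The two-sided ideal generated by the relators.\<close>

inductive_set nc_ideal :: "('k::field, 'n::finite) free_alg set" where
  zero: "0 \<in> nc_ideal"
| gen: "r \<in> nc_relators \<Longrightarrow> a * r * b \<in> nc_ideal"
| add: "x \<in> nc_ideal \<Longrightarrow> y \<in> nc_ideal \<Longrightarrow> x + y \<in> nc_ideal"

lemma nc_ideal_mult_left: "x \<in> nc_ideal \<Longrightarrow> c * x \<in> nc_ideal"
proof (induction rule: nc_ideal.induct)
  case (gen r a b)
  then show ?case using nc_ideal.gen[of r "c * a" b] by (simp add: mult.assoc)
qed (auto simp: distrib_left intro: nc_ideal.intros)

lemma nc_ideal_mult_right: "x \<in> nc_ideal \<Longrightarrow> x * c \<in> nc_ideal"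
proof (induction rule: nc_ideal.induct)
  case (gen r a b)
  then show ?case using nc_ideal.gen[of r a "b * c"] by (simp add: mult.assoc)
qed (auto simp: distrib_right intro: nc_ideal.intros)

lemma nc_ideal_uminus: "x \<in> nc_ideal \<Longrightarrow> - x \<in> nc_ideal"
  using nc_ideal_mult_left[of x "- 1"] by simp

lemma nc_ideal_diff: "x \<in> nc_ideal \<Longrightarrow> y \<in> nc_ideal \<Longrightarrow> x - y \<in> nc_ideal"
  using nc_ideal.add[of x "- y"] nc_ideal_uminus[of y] by simp

lemma free_alg_induct [case_names zero add]:
  fixes p :: "'a \<Rightarrow>\<^sub>0 'b::monoid_add"
  assumes "P 0" and "\<And>p k v. P p \<Longrightarrow> P (p + Poly_Mapping.single k v)"
  shows "P p"
proof (induction p rule: Poly_Mapping.update_induct)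
  case const
  show ?case by (rule assms(1))
next
  case (update f a b)
  have "Poly_Mapping.update a b f = f + Poly_Mapping.single a b"
    using update(1) by (intro poly_mapping_eqI)
      (auto simp: lookup_update lookup_add lookup_single when_def in_keys_iff)
  then show ?case using assms(2)[OF update(3)] by simp
qed

text \<open>The augmentation sending all generators to \<open>0\<close> shows that the ideal is proper.\<close>

lemma lookup_zero_mult:
  fixes p q :: "('k::field, 'n::finite) free_alg"
  shows "Poly_Mapping.lookup (p * q) 0 = Poly_Mapping.lookup p 0 * Poly_Mapping.lookup q 0"
proof (induction p rule: free_alg_induct)
  case (add p k v)
  have "Poly_Mapping.lookup (Poly_Mapping.single k v * q) 0
      = Poly_Mapping.lookup (Poly_Mapping.single k v) 0 * Poly_Mapping.lookup q 0"
  proof (induction q rule: free_alg_induct)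
    case (add q l u)
    have "k + l = 0 \<longleftrightarrow> k = 0 \<and> l = 0"
      by transfer auto
    then show ?case
      using add by (auto simp: distrib_left lookup_add mult_single lookup_single when_def)
  qed simp
  then show ?case using add by (simp add: distrib_right lookup_add)
qed simp

lemma lookup_zero_free_gen:
  assumes "i \<in> {1..<CARD('n)}"
  shows "Poly_Mapping.lookup (free_gen i :: ('k::field, 'n::finite) free_alg) 0 = 0"
proof -
  have "Abs_gen_word [i] \<noteq> (0 :: 'n gen_word)"
    using assms unfolding zero_gen_word_def by (subst Abs_gen_word_inject) auto
  then show ?thesis by (simp add: free_gen_def lookup_single when_def)
qed

lemma lookup_zero_nc_ideal:
  "x \<in> (nc_ideal :: ('k::field, 'n::finite) free_alg set) \<Longrightarrow> Poly_Mapping.lookup x 0 = 0"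
proof (induction rule: nc_ideal.induct)
  case (gen r a b)
  then have "Poly_Mapping.lookup r 0 = 0"
    by cases (auto simp: lookup_minus lookup_zero_mult lookup_zero_free_gen power2_eq_square)
  then show ?case by (simp add: lookup_zero_mult)
qed (auto simp: lookup_add)


section \<open>The Nilcoxeter algebra\<close>

text \<open>
  The algebra \<open>NC\<^sub>n\<close> over the field \<open>'k\<close> for \<open>n = CARD('n)\<close>; as types are nonempty, \<open>n \<ge> 1\<close>.
\<close>

quotient_type (overloaded) ('k, 'n) nilcoxeter = "('k::field, 'n::finite) free_alg" /
  "\<lambda>x y. x - y \<in> nc_ideal"
proof (rule equivpI)
  show "reflp (\<lambda>x y :: ('k, 'n) free_alg. x - y \<in> nc_ideal)"
    by (rule reflpI) (simp add: nc_ideal.zero)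
  show "symp (\<lambda>x y :: ('k, 'n) free_alg. x - y \<in> nc_ideal)"
    by (rule sympI) (metis minus_diff_eq nc_ideal_uminus)
  show "transp (\<lambda>x y :: ('k, 'n) free_alg. x - y \<in> nc_ideal)"
  proof (rule transpI)
    fix x y z :: "('k, 'n) free_alg"
    assume "x - y \<in> nc_ideal" "y - z \<in> nc_ideal"
    from nc_ideal.add[OF this] show "x - z \<in> nc_ideal" by simp
  qed
qed

instantiation nilcoxeter :: (field, finite) ring_1
begin

lift_definition zero_nilcoxeter :: "('a, 'b) nilcoxeter" is 0 .

lift_definition one_nilcoxeter :: "('a, 'b) nilcoxeter" is 1 .

lift_definition plus_nilcoxeter ::
  "('a, 'b) nilcoxeter \<Rightarrow> ('a, 'b) nilcoxeter \<Rightarrow> ('a, 'b) nilcoxeter" is "(+)"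
  using nc_ideal.add by (simp add: add_diff_add)

lift_definition uminus_nilcoxeter :: "('a, 'b) nilcoxeter \<Rightarrow> ('a, 'b) nilcoxeter" is uminus
  by (metis minus_diff_minus nc_ideal_uminus)

lift_definition minus_nilcoxeter ::
  "('a, 'b) nilcoxeter \<Rightarrow> ('a, 'b) nilcoxeter \<Rightarrow> ('a, 'b) nilcoxeter" is "(-)"
proof -
  fix x x' y y' :: "('a, 'b) free_alg"
  assume "x - x' \<in> nc_ideal" "y - y' \<in> nc_ideal"
  from nc_ideal_diff[OF this] show "x - y - (x' - y') \<in> nc_ideal"
    by (simp add: algebra_simps)
qed

lift_definition times_nilcoxeter ::
  "('a, 'b) nilcoxeter \<Rightarrow> ('a, 'b) nilcoxeter \<Rightarrow> ('a, 'b) nilcoxeter" is "(*)"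
proof -
  fix x x' y y' :: "('a, 'b) free_alg"
  assume "x - x' \<in> nc_ideal" "y - y' \<in> nc_ideal"
  from nc_ideal.add[OF nc_ideal_mult_right[OF this(1), of y] nc_ideal_mult_left[OF this(2), of x']]
  show "x * y - x' * y' \<in> nc_ideal"
    by (simp add: algebra_simps)
qed

instance
proof
  show "(0 :: ('a, 'b) nilcoxeter) \<noteq> 1"
  proof transfer
    show "(0 :: ('a, 'b) free_alg) - 1 \<notin> nc_ideal"
      using lookup_zero_nc_ideal[of "0 - 1 :: ('a, 'b) free_alg"]
      by (auto simp: lookup_minus lookup_one)
  qed
qed (transfer; simp add: algebra_simps nc_ideal.zero)+

end

lift_definition nc_scale :: "'k \<Rightarrow> ('k::field, 'n::finite) nilcoxeter \<Rightarrow> ('k, 'n) nilcoxeter"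
  is "\<lambda>c p. Poly_Mapping.single 0 c * p"
  by (metis nc_ideal_mult_left right_diff_distrib)

global_interpretation nc: vector_space "nc_scale :: 'k \<Rightarrow> ('k::field, 'n::finite) nilcoxeter \<Rightarrow> _"
  by unfold_locales
    (transfer; simp add: algebra_simps single_add mult_single nc_ideal.zero
      flip: mult.assoc)+

lift_definition nc_gen :: "nat \<Rightarrow> ('k::field, 'n::finite) nilcoxeter" is free_gen .

text \<open>By the braid relations, the choice of the reduced expression is immaterial.\<close>

definition nc_T :: "(nat \<Rightarrow> nat) \<Rightarrow> ('k::field, 'n::finite) nilcoxeter" where
  "nc_T w = prod_list (map nc_gen (SOME xs. reduced_expr CARD('n) xs w))"


section \<open>The involution and the twisted commutator subspace\<close>

lift_definition flip_word :: "'n::finite gen_word \<Rightarrow> 'n gen_word"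
  is "map (\<lambda>i. CARD('n) - i)" by (force simp: subset_iff)

lemma flip_word_flip_word [simp]: "flip_word (flip_word u) = u"
  by transfer (auto intro!: map_idI)

lemma inj_flip_word [simp]: "inj flip_word"
  by (metis flip_word_flip_word injI)

lemma flip_word_plus: "flip_word (u + v) = flip_word u + flip_word v"
  by transfer simp

lemma flip_word_zero [simp]: "flip_word 0 = 0"
  by transfer simp

text \<open>
  As \<^const>\<open>flip_word\<close> is its own inverse, precomposition with it maps the basis word \<open>u\<close> to
  \<open>flip_word u\<close>.
\<close>

definition free_flip :: "('k::field, 'n::finite) free_alg \<Rightarrow> ('k, 'n) free_alg" where
  "free_flip = Poly_Mapping.map_key flip_word"

lemma free_flip_single [simp]:
  "free_flip (Poly_Mapping.single u c) = Poly_Mapping.single (flip_word u) c"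
  unfolding free_flip_def by (metis flip_word_flip_word inj_flip_word map_key_single)

lemma free_flip_add: "free_flip (p + q) = free_flip p + free_flip q"
  by (simp add: free_flip_def map_key_plus)

lemma free_flip_zero [simp]: "free_flip 0 = 0"
  by (simp add: free_flip_def)

lemma free_flip_one [simp]: "free_flip 1 = 1"
  by (metis flip_word_zero free_flip_single single_one)

lemma free_flip_diff: "free_flip (p - q) = free_flip p - free_flip q"
  by (metis add_diff_cancel_right' diff_add_cancel free_flip_add)

lemma free_flip_mult: "free_flip (p * q) = free_flip p * free_flip q"
proof (induction p rule: free_alg_induct)
  case (add p k v)
  have "free_flip (Poly_Mapping.single k v * q)
      = Poly_Mapping.single (flip_word k) v * free_flip q"
    by (induction q rule: free_alg_induct)
      (simp_all add: distrib_left free_flip_add mult_single flip_word_plus)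
  then show ?case using add by (simp add: distrib_right free_flip_add)
qed simp

lemma free_flip_gen:
  assumes "i \<in> {1..<CARD('n)}"
  shows "free_flip (free_gen i :: ('k::field, 'n::finite) free_alg) = free_gen (CARD('n) - i)"
proof -
  have "flip_word (Abs_gen_word [i] :: 'n gen_word) = Abs_gen_word [CARD('n) - i]"
    using assms by (simp add: flip_word.abs_eq eq_onp_def)
  then show ?thesis by (simp add: free_gen_def)
qed

lemma free_flip_relator:
  assumes "r \<in> (nc_relators :: ('k::field, 'n::finite) free_alg set)"
  shows "free_flip r \<in> nc_ideal"
  using assms
proof cases
  case (braid i)
  define j where "j = CARD('n) - (i + 1)"
  have j: "1 \<le> j" "j + 1 < CARD('n)" "CARD('n) - i = j + 1" "CARD('n) - (i + 1) = j"
    using braid by (auto simp: j_def)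
  have "free_flip r = - (1 * (free_gen j * free_gen (j + 1) * free_gen j
      - free_gen (j + 1) * free_gen j * free_gen (j + 1)) * 1)"
    using braid j by (simp add: free_flip_diff free_flip_mult free_flip_gen del: One_nat_def Suc_eq_plus1 add_Suc_right)
  then show ?thesis
    using nc_ideal_uminus[OF nc_ideal.gen[OF nc_relators.braid[OF j(1,2)], of 1 1]] by simp
next
  case (commute i j)
  have "free_flip r = free_gen (CARD('n) - i) * free_gen (CARD('n) - j)
      - free_gen (CARD('n) - j) * free_gen (CARD('n) - i)"
    using commute by (simp add: free_flip_diff free_flip_mult free_flip_gen)
  moreover have "\<dots> \<in> nc_relators"
    using commute by (intro nc_relators.commute) auto
  ultimately show ?thesis
    using nc_ideal.gen[of "free_flip r" 1 1] by simp
next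
  case (nil i)
  have "free_flip r = free_gen (CARD('n) - i) ^ 2"
    using nil by (simp add: power2_eq_square free_flip_mult free_flip_gen)
  moreover have "\<dots> \<in> nc_relators"
    using nil by (intro nc_relators.nil) auto
  ultimately show ?thesis
    using nc_ideal.gen[of "free_flip r" 1 1] by simp
qed

lemma free_flip_ideal: "x \<in> nc_ideal \<Longrightarrow> free_flip x \<in> nc_ideal"
  by (induction rule: nc_ideal.induct)
    (auto simp: free_flip_add free_flip_mult
      intro: nc_ideal.intros nc_ideal_mult_left nc_ideal_mult_right free_flip_relator)

lift_definition nc_flip :: "('k::field, 'n::finite) nilcoxeter \<Rightarrow> ('k, 'n) nilcoxeter" is free_flip
  by (metis free_flip_diff free_flip_ideal)

lemma nc_flip_add: "nc_flip (a + b) = nc_flip a + nc_flip b"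
  by transfer (simp add: free_flip_add nc_ideal.zero)

lemma nc_flip_scale: "nc_flip (nc_scale c a) = nc_scale c (nc_flip a)"
  by transfer (simp add: free_flip_mult nc_ideal.zero)

lemma nc_flip_one: "nc_flip 1 = 1"
  by transfer (simp add: nc_ideal.zero)

lemma nc_flip_mult: "nc_flip (a * b) = nc_flip a * nc_flip b"
  by transfer (simp add: free_flip_mult nc_ideal.zero)

lemma nc_flip_gen:
  "i \<in> {1..<CARD('n)} \<Longrightarrow>
    nc_flip (nc_gen i :: ('k::field, 'n::finite) nilcoxeter) = nc_gen (CARD('n) - i)"
  by transfer (simp add: free_flip_gen nc_ideal.zero)

lemma nc_flip_flip: "nc_flip (nc_flip a) = a"
proof transfer
  fix p :: "('k::field, 'n::finite) free_alg"
  have "free_flip (free_flip p) = p"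
    by (induction p rule: free_alg_induct) (simp_all add: free_flip_add)
  then show "free_flip (free_flip p) - p \<in> nc_ideal" by (simp add: nc_ideal.zero)
qed

definition twisted_commutators :: "('k::field, 'n::finite) nilcoxeter set" where
  "twisted_commutators = nc.span {a * b - b * nc_flip a | a b. True}"

text \<open>
  Elements of the quotient space are represented by their cosets, so its zero is \<open>twisted_proj 0\<close>.
\<close>

definition twisted_proj :: "('k::field, 'n::finite) nilcoxeter \<Rightarrow> ('k, 'n) nilcoxeter set" where
  "twisted_proj x = {y. y - x \<in> twisted_commutators}"

definition nc_center :: "('k::field, 'n::finite) nilcoxeter set" where
  "nc_center = {z. \<forall>x. z * x = x * z}"

definition nc_graded_part :: "nat \<Rightarrow> ('k::field, 'n::finite) nilcoxeter set" where
  "nc_graded_part d = nc.span {nc_T w | w. w permutes {1..CARD('n)} \<and> cox_length CARD('n) w = d}"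

end

(*
  Let t(a) be the coefficient of T_{w0} in a. As T_w T_v involves T_{w0} iff v = w^{-1} w0, the form
  t(ab) is nondegenerate, and s_i w0 = w0 s_{n-i} makes it symmetric up to the twist:
  t(ab) = t(b f(a)). Hence z is central iff the functional t(- z) kills [A,A]_t. That space is
  spanned by the elements T_i T_w - T_w T_{n-i}, each of which is, up to sign, 0, a basis element or a
  difference of two basis elements of equal length. So the indicator function of a nonzero class
  c (even restricted to a fixed length) is a functional that kills [A,A]_t, the elements of c have equal
  length, and the indicator functions form a basis of all functionals killing [A,A]_t; z_c is the
  element that represents the one of c. Linear independence of the T_w comes from an action of words
  on permutations, and the independence of T_w of the reduced expression is Matsumoto's theorem.
*)
theory Submission
  imports Defs
begin

section \<open>Length and inversions\<close>

abbreviation adj :: "nat \<Rightarrow> nat \<Rightarrow> nat" where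
  "adj i \<equiv> transpose i (Suc i)"

lemma adj_permutes: "i \<in> {1..<n} \<Longrightarrow> adj i permutes {1..n}"
  by (rule permutes_swap_id) auto

lemma adj_comp_permutes: "w permutes {1..n} \<Longrightarrow> i \<in> {1..<n} \<Longrightarrow> adj i \<circ> w permutes {1..n}"
  by (rule permutes_compose[OF _ adj_permutes])

lemma inv_adj_comp: "w permutes {1..n} \<Longrightarrow> inv (adj i \<circ> w) = inv w \<circ> adj i"
  using o_inv_distrib[of "adj i" w] by (simp add: permutes_bij)

lemma adj_adj_comp [simp]: "adj i \<circ> (adj i \<circ> w) = w"
  by (simp flip: comp_assoc)

definition inversions :: "nat \<Rightarrow> (nat \<Rightarrow> nat) \<Rightarrow> (nat \<times> nat) set" where
  "inversions n w = {(a, b). a \<in> {1..n} \<and> b \<in> {1..n} \<and> a < b \<and> w b < w a}"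

lemma finite_inversions [simp]: "finite (inversions n w)"
  by (rule finite_subset[of _ "{1..n} \<times> {1..n}"]) (auto simp: inversions_def)

text \<open>Swapping the values \<open>i\<close> and \<open>Suc i\<close> leaves their order
  relative to every other value unchanged, so only the pair of positions carrying these two values
  can change status.\<close>

lemma inversions_adj_comp:
  assumes w: "w permutes {1..n}" and i: "i \<in> {1..<n}" and asc: "inv w i < inv w (Suc i)"
  shows "inversions n (adj i \<circ> w) = insert (inv w i, inv w (Suc i)) (inversions n w)"
    and "(inv w i, inv w (Suc i)) \<notin> inversions n w"
proof -
  have w': "w (inv w x) = x" for x
    by (rule permutes_inverses(1)[OF w])
  have eq: "w a = x \<longleftrightarrow> a = inv w x" for a x
    using permutes_inverses[OF w] by metis
  have mem: "inv w i \<in> {1..n}" "inv w (Suc i) \<in> {1..n}"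
    using i permutes_in_image[OF permutes_inv[OF w]] by auto
  have cmp: "adj i y < adj i x \<longleftrightarrow> (if x = i \<and> y = Suc i then True
      else if x = Suc i \<and> y = i then False else y < x)" for x y
    by (auto simp: transpose_def)
  have "(a, b) \<in> inversions n (adj i \<circ> w)
      \<longleftrightarrow> (a, b) \<in> insert (inv w i, inv w (Suc i)) (inversions n w)" for a b
    using mem asc unfolding inversions_def by (auto simp: cmp eq w' split: if_splits)
  then show "inversions n (adj i \<circ> w) = insert (inv w i, inv w (Suc i)) (inversions n w)"
    by auto
  show "(inv w i, inv w (Suc i)) \<notin> inversions n w"
    by (simp add: inversions_def w')
qed

lemma card_inversions_adj_comp:
  assumes w: "w permutes {1..n}" and i: "i \<in> {1..<n}"
  shows "inv w i < inv w (Suc i) \<Longrightarrow>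
      card (inversions n (adj i \<circ> w)) = Suc (card (inversions n w))"
    and "inv w (Suc i) < inv w i \<Longrightarrow>
      card (inversions n w) = Suc (card (inversions n (adj i \<circ> w)))"
proof -
  have asc: "card (inversions n (adj i \<circ> v)) = Suc (card (inversions n v))"
    if "v permutes {1..n}" "inv v i < inv v (Suc i)" for v
    using inversions_adj_comp[OF that(1) i that(2)] by simp
  show "inv w i < inv w (Suc i) \<Longrightarrow>
      card (inversions n (adj i \<circ> w)) = Suc (card (inversions n w))"
    using asc[OF w] .
  \<comment> \<open>The descent case is the ascent case for \<open>adj i \<circ> w\<close>, because
    \<open>adj i\<close> is an involution.\<close>
  show "card (inversions n w) = Suc (card (inversions n (adj i \<circ> w)))"
    if "inv w (Suc i) < inv w i"
    using asc[OF adj_comp_permutes[OF w i]] that by (simp add: inv_adj_comp[OF w])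
qed

lemma inv_neq_adj:
  assumes "w permutes {1..n}"
  shows "inv w i \<noteq> inv w (Suc i)"
  using permutes_inj[OF permutes_inv[OF assms]] by (metis injD n_not_Suc_n)

section \<open>Words and the permutations they spell\<close>

lemma perm_of_simps [simp]:
  "perm_of [] = id" "perm_of (i # xs) = adj i \<circ> perm_of xs"
  by (simp_all add: perm_of_def)

lemma perm_of_append: "perm_of (xs @ ys) = perm_of xs \<circ> perm_of ys"
  by (induction xs) (simp_all add: comp_assoc)

lemma perm_of_permutes: "set xs \<subseteq> {1..<n} \<Longrightarrow> perm_of xs permutes {1..n}"
proof (induction xs)
  case (Cons i xs)
  then have "perm_of (i # xs) permutes {1..n}"
    using adj_comp_permutes[of "perm_of xs" n i] by simp
  then show ?case .
qed (simp add: permutes_id)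

text \<open>Each letter changes the number of inversions by exactly one; this is the lower bound for
  the Coxeter length.\<close>

lemma card_inversions_perm_of_le:
  "set xs \<subseteq> {1..<n} \<Longrightarrow> card (inversions n (perm_of xs)) \<le> length xs"
proof (induction xs)
  case Nil
  \<comment> \<open>The induction leaves \<^term>\<open>perm_of\<close> eta-expanded in the goal, where simp would expand compositions
    pointwise; hence the explicit restatement, here and in later inductions.\<close>
  have "inversions n id = {}" by (auto simp: inversions_def)
  then have "card (inversions n (perm_of [])) \<le> length []" by simp
  then show ?case .
next
  case (Cons i xs)
  then have p: "perm_of xs permutes {1..n}" and i: "i \<in> {1..<n}" and
    le: "card (inversions n (perm_of xs)) \<le> length xs"
    using perm_of_permutes[of xs n] by auto
  have "card (inversions n (perm_of (i # xs))) \<le> length (i # xs)"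
    using le inv_neq_adj[OF p, of i] card_inversions_adj_comp[OF p i]
    by (cases "inv (perm_of xs) i < inv (perm_of xs) (Suc i)") auto
  then show ?case .
qed

text \<open>Integers that increase strictly from at least 1 satisfy \<open>i \<le> q i\<close>, and
  a permutation that lowers no point is the identity.\<close>

lemma increasing_permutes_eq_id:
  assumes q: "q permutes {1..n::nat}" and inc: "\<And>i. i \<in> {1..<n} \<Longrightarrow> q i < q (Suc i)"
  shows "q = id"
proof (rule permutes_natset_ge[OF q], rule ballI)
  have "1 \<le> i \<longrightarrow> i \<le> n \<longrightarrow> i \<le> q i" for i
  proof (induction i)
    case (Suc i)
    show ?case
    proof (cases "i = 0")
      case True
      then show ?thesis using permutes_in_image[OF q, of "Suc 0"] by auto
    next
      case False
      then show ?thesis using Suc inc[of i] by auto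
    qed
  qed simp
  then show "i \<le> q i" if "i \<in> {1..n}" for i using that by auto
qed

text \<open>A descent of \<open>inv w\<close> yields a letter whose removal from the left lowers the
  inversion count by one; without descents \<open>w\<close> is the identity. This is the upper bound
  for the Coxeter length.\<close>

lemma inversion_word_exists:
  "w permutes {1..n} \<Longrightarrow> \<exists>xs. expresses n xs w \<and> length xs = card (inversions n w)"
proof (induction "card (inversions n w)" arbitrary: w rule: less_induct)
  case less
  show ?case
  proof (cases "\<exists>i\<in>{1..<n}. inv w (Suc i) < inv w i")
    case True
    then obtain i where i: "i \<in> {1..<n}" "inv w (Suc i) < inv w i" by blast
    note c = card_inversions_adj_comp(2)[OF less.prems i]
    obtain xs where xs: "expresses n xs (adj i \<circ> w)"
      "length xs = card (inversions n (adj i \<circ> w))"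
      using less.hyps[OF _ adj_comp_permutes[OF less.prems i(1)]] c by auto
    have "expresses n (i # xs) w"
      using xs(1) i(1) by (auto simp: expresses_def)
    then show ?thesis using xs(2) c by (intro exI[of _ "i # xs"]) simp
  next
    case False
    have "inv w i < inv w (Suc i)" if "i \<in> {1..<n}" for i
      using False inv_neq_adj[OF less.prems, of i] that by (meson linorder_neqE_nat)
    then have "inv w = id"
      using permutes_inv[OF less.prems] by (intro increasing_permutes_eq_id)
    then have "w = id" using permutes_inv_inv[OF less.prems] by simp
    then have "inversions n w = {}" "expresses n [] w"
      by (auto simp: inversions_def expresses_def)
    then show ?thesis by (intro exI[of _ "[]"]) simp
  qed
qed

lemma cox_length_eq_card_inversions:
  assumes "w permutes {1..n}"
  shows "cox_length n w = card (inversions n w)"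
  unfolding cox_length_def
proof (rule Least_equality)
  show "\<exists>xs. expresses n xs w \<and> length xs = card (inversions n w)"
    by (rule inversion_word_exists[OF assms])
  show "card (inversions n w) \<le> l" if "\<exists>xs. expresses n xs w \<and> length xs = l" for l
    using that card_inversions_perm_of_le by (auto simp: expresses_def)
qed

section \<open>Reduced expressions and left descents\<close>

lemma reduced_expr_exists: "w permutes {1..n} \<Longrightarrow> \<exists>xs. reduced_expr n xs w"
  using inversion_word_exists cox_length_eq_card_inversions by (metis reduced_expr_def)

lemma reduced_expr_permutes: "reduced_expr n xs w \<Longrightarrow> w permutes {1..n}"
  using perm_of_permutes by (auto simp: reduced_expr_def expresses_def)

lemma cox_length_le: "expresses n xs w \<Longrightarrow> cox_length n w \<le> length xs"
  unfolding cox_length_def by (rule Least_le) blast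

lemma cox_length_adj_comp:
  assumes "w permutes {1..n}" "i \<in> {1..<n}"
  shows "inv w i < inv w (Suc i) \<Longrightarrow> cox_length n (adj i \<circ> w) = Suc (cox_length n w)"
    and "inv w (Suc i) < inv w i \<Longrightarrow> cox_length n w = Suc (cox_length n (adj i \<circ> w))"
  using card_inversions_adj_comp[OF assms] assms adj_comp_permutes[OF assms]
  by (simp_all add: cox_length_eq_card_inversions)

lemma cox_length_id [simp]: "cox_length n id = 0"
  by (metis cox_length_le expresses_def perm_of_simps(1) list.size(3) le_zero_eq
      empty_set empty_subsetI)

lemma reduced_expr_ConsI:
  assumes "reduced_expr n xs (adj i \<circ> w)" "w permutes {1..n}" "i \<in> {1..<n}"
    "inv w (Suc i) < inv w i"
  shows "reduced_expr n (i # xs) w"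
  using assms cox_length_adj_comp(2)[OF assms(2-4)]
  by (auto simp: reduced_expr_def expresses_def)

text \<open>The length of \<open>u\<close>, the permutation of the tail, is at most the number of
  letters in the tail, so the length must rise from \<open>u\<close> to \<open>w\<close>; hence the
  tail is reduced and \<open>i\<close> is a left descent of \<open>w\<close>.\<close>

lemma reduced_expr_ConsD:
  assumes "reduced_expr n (i # xs) w"
  shows "i \<in> {1..<n}" "reduced_expr n xs (adj i \<circ> w)" "inv w (Suc i) < inv w i"
proof -
  define u where "u = perm_of xs"
  have i: "i \<in> {1..<n}" and xs: "set xs \<subseteq> {1..<n}" and w: "w = adj i \<circ> u"
    and len: "cox_length n w = Suc (length xs)"
    using assms by (auto simp: reduced_expr_def expresses_def u_def)
  have u: "u permutes {1..n}" using perm_of_permutes[OF xs] by (simp add: u_def)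
  have ex: "expresses n xs u" using xs by (simp add: expresses_def u_def)
  have asc: "inv u i < inv u (Suc i)"
    using cox_length_adj_comp(2)[OF u i] cox_length_le[OF ex] len inv_neq_adj[OF u, of i]
    unfolding w by (cases "inv u i < inv u (Suc i)") auto
  show "i \<in> {1..<n}" by (rule i)
  show "reduced_expr n xs (adj i \<circ> w)"
    using ex len cox_length_adj_comp(1)[OF u i asc] by (simp add: reduced_expr_def w)
  show "inv w (Suc i) < inv w i"
    using asc by (simp add: w inv_adj_comp[OF u])
qed

text \<open>The letters are involutions, so inverting a product only reverses their order.\<close>

lemma expresses_rev: "expresses n xs w \<Longrightarrow> expresses n (rev xs) (inv w)"
proof (induction xs arbitrary: w)
  case (Cons i xs)
  then have xs: "set xs \<subseteq> {1..<n}" "i \<in> {1..<n}" and w: "w = adj i \<circ> perm_of xs"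
    by (auto simp: expresses_def)
  have "perm_of (rev xs) = inv (perm_of xs)"
    using Cons.IH[of "perm_of xs"] xs by (simp add: expresses_def)
  then have "perm_of (rev (i # xs)) = inv w"
    unfolding w inv_adj_comp[OF perm_of_permutes[OF xs(1)]] by (simp add: perm_of_append)
  then show ?case using xs by (simp add: expresses_def)
qed (simp add: expresses_def)

lemma cox_length_inv:
  assumes "w permutes {1..n}"
  shows "cox_length n (inv w) = cox_length n w"
proof -
  have le: "cox_length n (inv v) \<le> cox_length n v" if "v permutes {1..n}" for v
    using reduced_expr_exists[OF that] expresses_rev cox_length_le
    by (metis reduced_expr_def length_rev)
  show ?thesis
    using le[OF assms] le[OF permutes_inv[OF assms]] permutes_inv_inv[OF assms] by simp
qed

section \<open>Matsumoto's theorem\<close>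

text \<open>Induction on length. If two reduced words of \<open>w\<close> start with different
  letters \<open>i\<close> and \<open>j\<close>, both are left descents, so \<open>w\<close> has
  reduced words that start with the longest element of the subgroup generated by these two
  reflections. The induction hypothesis connects each given word to one of them, and a single
  relation connects these in turn.\<close>

lemma matsumoto:
  fixes g :: "nat \<Rightarrow> 'a::monoid_mult"
  assumes braid: "\<And>i. 1 \<le> i \<Longrightarrow> Suc i < n \<Longrightarrow>
      g i * (g (Suc i) * g i) = g (Suc i) * (g i * g (Suc i))"
    and commute: "\<And>i j. i \<in> {1..<n} \<Longrightarrow> j \<in> {1..<n} \<Longrightarrow> Suc i < j \<Longrightarrow> g i * g j = g j * g i"
    and "reduced_expr n xs w" "reduced_expr n ys w"
  shows "prod_list (map g xs) = prod_list (map g ys)"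
  using assms(3,4)
proof (induction "length xs" arbitrary: xs ys w rule: less_induct)
  case less
  let ?g = "\<lambda>xs. prod_list (map g xs)"
  \<comment> \<open>Stated for \<open>i < j\<close> with its own induction hypothesis, so that it
    applies with the two words in either order.\<close>
  have main: "g i * ?g xs = g j * ?g ys"
    if red: "reduced_expr n (i # xs) w" "reduced_expr n (j # ys) w"
      and IH: "\<And>us vs v. length us = length xs \<Longrightarrow>
        reduced_expr n us v \<Longrightarrow> reduced_expr n vs v \<Longrightarrow> ?g us = ?g vs"
      and ij: "i < j" for i j xs ys
  proof -
    have w: "w permutes {1..n}" using red(1) by (rule reduced_expr_permutes)
    have len: "length ys = length xs" using red by (auto simp: reduced_expr_def)
    note i = reduced_expr_ConsD[OF red(1)] and j = reduced_expr_ConsD[OF red(2)]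
    note wi = adj_comp_permutes[OF w i(1)] and wj = adj_comp_permutes[OF w j(1)]
    note wij = adj_comp_permutes[OF wj i(1)] and wji = adj_comp_permutes[OF wi j(1)]
    show ?thesis
    proof (cases "j = Suc i")
      case False
      have comm: "adj j \<circ> (adj i \<circ> w) = adj i \<circ> (adj j \<circ> w)"
        using False ij by (auto simp: fun_eq_iff transpose_def)
      \<comment> \<open>A common tail: both \<open>i # j # us\<close> and \<open>j # i # us\<close>
        are reduced words of \<open>w\<close>.\<close>
      obtain us where us: "reduced_expr n us (adj j \<circ> (adj i \<circ> w))"
        using reduced_expr_exists[OF wji] by blast
      have "reduced_expr n (j # us) (adj i \<circ> w)"
        by (rule reduced_expr_ConsI[OF us wi j(1)])
          (use j(3) False ij in \<open>simp add: inv_adj_comp[OF w]\<close>)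
      from IH[OF _ i(2) this] have 1: "?g xs = g j * ?g us" by simp
      have "reduced_expr n (i # us) (adj j \<circ> w)"
        by (rule reduced_expr_ConsI[OF us[unfolded comm] wj i(1)])
          (use i(3) False ij in \<open>simp add: inv_adj_comp[OF w]\<close>)
      from IH[OF len j(2) this] have 2: "?g ys = g i * ?g us" by simp
      show ?thesis
        using commute[OF i(1) j(1)] False ij by (simp add: 1 2 flip: mult.assoc)
    next
      case True
      note wiji = adj_comp_permutes[OF wji i(1)]
      note inv = inv_adj_comp[OF w] inv_adj_comp[OF wi] inv_adj_comp[OF wj, unfolded True]
      \<comment> \<open>The values of \<open>inv w\<close> decrease along \<open>i\<close>,
        \<open>i + 1\<close>, \<open>i + 2\<close>, so three alternating letters can be split off
        from the left, whichever of the two comes first.\<close>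
      have desc: "inv w (Suc j) < inv w j" "inv w j < inv w i"
        using i(3) j(3) True by auto
      have comm: "adj i \<circ> (adj j \<circ> (adj i \<circ> w)) = adj j \<circ> (adj i \<circ> (adj j \<circ> w))"
        using True by (auto simp: fun_eq_iff transpose_def)
      obtain us where us: "reduced_expr n us (adj i \<circ> (adj j \<circ> (adj i \<circ> w)))"
        using reduced_expr_exists[OF wiji] by blast
      have "reduced_expr n (i # us) (adj j \<circ> (adj i \<circ> w))"
        by (rule reduced_expr_ConsI[OF us wji i(1)]) (use desc True in \<open>simp add: inv\<close>)
      then have "reduced_expr n (j # i # us) (adj i \<circ> w)"
        by (rule reduced_expr_ConsI[OF _ wi j(1)]) (use desc True in \<open>simp add: inv\<close>)
      from IH[OF _ i(2) this] have 1: "?g xs = g j * (g i * ?g us)" by simp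
      have "reduced_expr n (j # us) (adj i \<circ> (adj j \<circ> w))"
        by (rule reduced_expr_ConsI[OF us[unfolded comm] wij j(1)])
          (use desc True in \<open>simp add: inv\<close>)
      then have "reduced_expr n (i # j # us) (adj j \<circ> w)"
        by (rule reduced_expr_ConsI[OF _ wj i(1)]) (use desc True in \<open>simp add: inv\<close>)
      from IH[OF len j(2) this] have 2: "?g ys = g i * (g j * ?g us)" by simp
      show ?thesis
        using braid[of i] i(1) j(1) True by (simp add: 1 2 flip: mult.assoc)
    qed
  qed
  have len: "length ys = length xs" using less.prems by (simp add: reduced_expr_def)
  show ?case
  proof (cases xs)
    case Nil
    then show ?thesis using len by simp
  next
    case (Cons i xs')
    then obtain j ys' where ys: "ys = j # ys'" using len by (cases ys) auto
    have IH: "?g us = ?g vs" if "length us = length xs'"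
      "reduced_expr n us v" "reduced_expr n vs v" for us vs v
      by (rule less.hyps[OF _ that(2,3)]) (simp add: that(1) Cons)
    have len': "length ys' = length xs'" using len Cons ys by simp
    have red: "reduced_expr n (i # xs') w" "reduced_expr n (j # ys') w"
      using less.prems Cons ys by simp_all
    consider "i = j" | "i < j" | "j < i" by linarith
    then show ?thesis
    proof cases
      case 1
      then have "?g xs' = ?g ys'"
        using IH[OF refl reduced_expr_ConsD(2)[OF red(1)]] reduced_expr_ConsD(2)[OF red(2)] by blast
      then show ?thesis using 1 Cons ys by simp
    next
      case 2
      then show ?thesis
        using main[OF red(1,2) IH] Cons ys by simp
    next
      case 3
      \<comment> \<open>With the words exchanged, \<open>main\<close> measures lengths by
        \<open>ys'\<close>; \<open>len'\<close> converts the induction hypothesis.\<close>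
      then show ?thesis
        using main[OF red(2,1) IH[folded len']] Cons ys by simp
    qed
  qed
qed

section \<open>The longest permutation\<close>

definition reversal :: "nat \<Rightarrow> nat \<Rightarrow> nat" where
  "reversal n a = (if a \<in> {1..n} then Suc n - a else a)"

lemma reversal_reversal [simp]: "reversal n \<circ> reversal n = id"
  by (auto simp: reversal_def fun_eq_iff)

lemma reversal_permutes: "reversal n permutes {1..n}"
  by (rule bij_imp_permutes)
    (auto simp: reversal_def intro!: bij_betw_byWitness[where f' = "reversal n"])

lemma inv_reversal [simp]: "inv (reversal n) = reversal n"
  by (rule inv_unique_comp) simp_all

lemma reversal_less_iff:
  "a \<in> {1..n} \<Longrightarrow> b \<in> {1..n} \<Longrightarrow> reversal n a < reversal n b \<longleftrightarrow> b < a"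
  by (auto simp: reversal_def)

text \<open>Following \<open>q\<close> by the reversal turns decrease into increase.\<close>

lemma decreasing_permutes_eq_reversal:
  assumes q: "q permutes {1..n}" and dec: "\<And>i. i \<in> {1..<n} \<Longrightarrow> q (Suc i) < q i"
  shows "q = reversal n"
proof -
  have "reversal n \<circ> q = id"
  proof (rule increasing_permutes_eq_id)
    show "reversal n \<circ> q permutes {1..n}"
      by (rule permutes_compose[OF q reversal_permutes])
    show "(reversal n \<circ> q) i < (reversal n \<circ> q) (Suc i)" if "i \<in> {1..<n}" for i
      using dec[OF that] that permutes_in_image[OF q, of i] permutes_in_image[OF q, of "Suc i"]
      by (simp add: reversal_less_iff)
  qed
  then have "reversal n \<circ> (reversal n \<circ> q) = reversal n" by simp
  then show ?thesis by (simp flip: comp_assoc)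
qed

text \<open>A maximum exists because there are finitely many permutations. At a permutation of
  maximal length no letter can be an ascent, so its inverse is decreasing.\<close>

lemma longest_perm_eq_reversal: "longest_perm n = reversal n"
proof -
  let ?P = "\<lambda>w. w permutes {1..n}"
  have fin: "finite {w. ?P w}" by (rule finite_permutations) simp
  have "is_arg_max (cox_length n) ?P (longest_perm n)"
  proof -
    have "\<exists>w. is_arg_max (cox_length n) ?P w"
    proof -
      obtain w where "?P w" "cox_length n w = Max (cox_length n ` {w. ?P w})"
        using Max_in[of "cox_length n ` {w. ?P w}"] fin permutes_id by fastforce
      then have "is_arg_max (cox_length n) ?P w"
        using fin by (auto simp: is_arg_max_linorder)
      then show ?thesis by blast
    qed
    then show ?thesis
      unfolding longest_perm_def arg_max_def by (rule someI_ex)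
  qed
  then have w: "?P (longest_perm n)"
    and max: "\<And>v. ?P v \<Longrightarrow> cox_length n v \<le> cox_length n (longest_perm n)"
    by (auto simp: is_arg_max_linorder)
  have "inv (longest_perm n) = reversal n"
  proof (rule decreasing_permutes_eq_reversal[OF permutes_inv[OF w]])
    show "inv (longest_perm n) (Suc i) < inv (longest_perm n) i" if "i \<in> {1..<n}" for i
      using cox_length_adj_comp(1)[OF w that] max[OF adj_comp_permutes[OF w that]]
        inv_neq_adj[OF w, of i] by (cases rule: linorder_cases) auto
  qed
  then show ?thesis by (metis inv_reversal permutes_inv_inv[OF w])
qed

text \<open>Removing a left descent shortens \<open>w\<close> by one and lengthens
  \<open>w \<circ> reversal n\<close> by one, because
  \<open>inv (w \<circ> reversal n) = reversal n \<circ> inv w\<close> reverses the comparison; the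
  sum is constant down to the identity.\<close>

lemma cox_length_comp_reversal:
  assumes "w permutes {1..n}"
  shows "cox_length n w + cox_length n (w \<circ> reversal n) = cox_length n (reversal n)"
  using assms
proof (induction "cox_length n w" arbitrary: w)
  case 0
  then obtain xs where "reduced_expr n xs w" using reduced_expr_exists by blast
  with 0 have "w = id" by (auto simp: reduced_expr_def expresses_def)
  then show ?case using 0 by simp
next
  case (Suc m)
  obtain i xs where xs: "reduced_expr n (i # xs) w"
    using reduced_expr_exists[OF Suc.prems] Suc.hyps(2)
    by (metis reduced_expr_def length_Suc_conv)
  note i = reduced_expr_ConsD[OF xs]
  note w = adj_comp_permutes[OF Suc.prems i(1)]
  note wr = permutes_compose[OF reversal_permutes Suc.prems]
  have len: "cox_length n w = Suc (cox_length n (adj i \<circ> w))"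
    by (rule cox_length_adj_comp(2)[OF Suc.prems i(1,3)])
  have "inv (w \<circ> reversal n) = reversal n \<circ> inv w"
    using o_inv_distrib[OF permutes_bij[OF Suc.prems] permutes_bij[OF reversal_permutes, of n]]
    by simp
  moreover have "inv w i \<in> {1..n}" "inv w (Suc i) \<in> {1..n}"
    using i(1) permutes_in_image[OF permutes_inv[OF Suc.prems]] by auto
  ultimately have "inv (w \<circ> reversal n) i < inv (w \<circ> reversal n) (Suc i)"
    using i(3) by (simp add: reversal_less_iff)
  from cox_length_adj_comp(1)[OF wr i(1) this]
  have "cox_length n ((adj i \<circ> w) \<circ> reversal n) = Suc (cox_length n (w \<circ> reversal n))"
    by (simp add: comp_assoc)
  then show ?case using Suc.hyps(1)[OF _ w] Suc.hyps(2) len by simp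
qed

text \<open>Conjugating a transposition moves its two points; here they become \<open>n - i\<close>
  and its successor. This is the source of the twist \<open>T_i \<mapsto> T_{n-i}\<close>.\<close>

lemma adj_comp_reversal:
  assumes "i \<in> {1..<n}"
  shows "adj i \<circ> reversal n = reversal n \<circ> adj (n - i)"
proof -
  have "reversal n i = Suc (n - i)" "reversal n (Suc i) = n - i"
    using assms by (auto simp: reversal_def)
  then show ?thesis
    using transpose_comp_eq[OF permutes_bij[OF reversal_permutes], of i "Suc i" n]
    by (simp add: transpose_commute)
qed

section \<open>The basis of the Nilcoxeter algebra\<close>

lemma nc_gen_square:
  assumes "i \<in> {1..<CARD('n)}"
  shows "nc_gen i * nc_gen i = (0 :: ('k::field, 'n::finite) nilcoxeter)"
proof (transfer fixing: i)
  show "free_gen i * free_gen i - 0 \<in> (nc_ideal :: ('k, 'n) free_alg set)"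
    using nc_ideal.gen[OF nc_relators.nil[OF assms], of 1 1] by (simp add: power2_eq_square)
qed

lemma nc_gen_commute:
  assumes "i \<in> {1..<CARD('n)}" "j \<in> {1..<CARD('n)}" "Suc i < j"
  shows "nc_gen i * nc_gen j = (nc_gen j * nc_gen i :: ('k::field, 'n::finite) nilcoxeter)"
proof (transfer fixing: i j)
  show "free_gen i * free_gen j - free_gen j * free_gen i \<in> (nc_ideal :: ('k, 'n) free_alg set)"
    using nc_ideal.gen[OF nc_relators.commute[OF assms(1,2)], of 1 1] assms(3) by simp
qed

lemma nc_gen_braid:
  assumes "1 \<le> i" "Suc i < CARD('n)"
  shows "nc_gen i * (nc_gen (Suc i) * nc_gen i) =
    (nc_gen (Suc i) * (nc_gen i * nc_gen (Suc i)) :: ('k::field, 'n::finite) nilcoxeter)"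
proof (transfer fixing: i)
  show "free_gen i * (free_gen (Suc i) * free_gen i) -
      free_gen (Suc i) * (free_gen i * free_gen (Suc i)) \<in> (nc_ideal :: ('k, 'n) free_alg set)"
    using nc_ideal.gen[OF nc_relators.braid[of i], of 1 1] assms by (simp add: mult.assoc)
qed

text \<open>By Matsumoto's theorem, the arbitrary choice in \<open>nc_T\<close> does not
  matter.\<close>

lemma prod_nc_gen_reduced_expr:
  assumes "reduced_expr CARD('n) xs w"
  shows "prod_list (map nc_gen xs) = (nc_T w :: ('k::field, 'n::finite) nilcoxeter)"
  unfolding nc_T_def
proof (rule matsumoto[where n = "CARD('n)" and w = w])
  show "reduced_expr CARD('n) (SOME xs. reduced_expr CARD('n) xs w) w"
    using assms by (rule someI)
qed (use assms in \<open>auto intro: nc_gen_braid nc_gen_commute\<close>)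

lemma nc_T_id: "nc_T id = (1 :: ('k::field, 'n::finite) nilcoxeter)"
  using prod_nc_gen_reduced_expr[of "[]" id, where 'k = 'k and 'n = 'n]
  by (simp add: reduced_expr_def expresses_def)

text \<open>At an ascent a reduced word of \<open>w\<close> stays reduced with \<open>i\<close> in
  front; at a descent \<open>w\<close> has a reduced word starting with \<open>i\<close>, and the
  product contains the square of \<open>nc_gen i\<close>.\<close>

lemma nc_gen_mult_T:
  assumes w: "w permutes {1..CARD('n)}" and i: "i \<in> {1..<CARD('n)}"
  shows "nc_gen i * nc_T w = (if inv w i < inv w (Suc i) then nc_T (adj i \<circ> w)
    else 0 :: ('k::field, 'n::finite) nilcoxeter)"
proof (cases "inv w i < inv w (Suc i)")
  case True
  obtain xs where xs: "reduced_expr CARD('n) xs w" using reduced_expr_exists[OF w] by blast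
  have "reduced_expr CARD('n) (i # xs) (adj i \<circ> w)"
    by (rule reduced_expr_ConsI[OF _ adj_comp_permutes[OF w i] i])
      (use xs True in \<open>simp_all add: inv_adj_comp[OF w]\<close>)
  then show ?thesis
    using prod_nc_gen_reduced_expr[of "i # xs", where 'k = 'k and 'n = 'n] True
    by (simp add: prod_nc_gen_reduced_expr[OF xs])
next
  case False
  then have desc: "inv w (Suc i) < inv w i" using inv_neq_adj[OF w, of i] by simp
  obtain xs where xs: "reduced_expr CARD('n) xs (adj i \<circ> w)"
    using reduced_expr_exists[OF adj_comp_permutes[OF w i]] by blast
  have "nc_T w = (nc_gen i * prod_list (map nc_gen xs) :: ('k, 'n) nilcoxeter)"
    using prod_nc_gen_reduced_expr[OF reduced_expr_ConsI[OF xs w i desc], where 'k = 'k]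
    by simp
  then show ?thesis
    using False by (simp add: nc_gen_square[OF i] flip: mult.assoc)
qed

text \<open>A word stops being reduced at the letter, read from the right, where the length fails to
  rise, and there \<open>nc_gen_mult_T\<close> gives zero.\<close>

lemma prod_nc_gen:
  assumes "set xs \<subseteq> {1..<CARD('n)}"
  shows "prod_list (map nc_gen xs) = (if cox_length CARD('n) (perm_of xs) = length xs
    then nc_T (perm_of xs) else 0 :: ('k::field, 'n::finite) nilcoxeter)"
  using assms
proof (induction xs)
  case Nil
  have "prod_list (map nc_gen []) = (if cox_length CARD('n) (perm_of []) = length []
    then nc_T (perm_of []) else 0 :: ('k, 'n) nilcoxeter)"
    by (simp add: nc_T_id)
  then show ?case .
next
  case (Cons i xs)
  let ?u = "perm_of xs" and ?l = "cox_length CARD('n)"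
  have i: "i \<in> {1..<CARD('n)}" and xs: "set xs \<subseteq> {1..<CARD('n)}" using Cons.prems by auto
  have u: "?u permutes {1..CARD('n)}" by (rule perm_of_permutes[OF xs])
  have le: "?l ?u \<le> length xs" using xs by (intro cox_length_le) (simp add: expresses_def)
  have "nc_gen i * prod_list (map nc_gen xs) = (if ?l (adj i \<circ> ?u) = Suc (length xs)
    then nc_T (adj i \<circ> ?u) else 0 :: ('k, 'n) nilcoxeter)"
  proof (cases "inv ?u i < inv ?u (Suc i)")
    case True
    then show ?thesis
      using cox_length_adj_comp(1)[OF u i True] nc_gen_mult_T[OF u i, where 'k = 'k]
        Cons.IH[OF xs] by simp
  next
    case False
    then have "inv ?u (Suc i) < inv ?u i" using inv_neq_adj[OF u, of i] by simp
    then have "?l (adj i \<circ> ?u) < Suc (length xs)"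
      using cox_length_adj_comp(2)[OF u i] le by simp
    then show ?thesis
      using False nc_gen_mult_T[OF u i, where 'k = 'k] Cons.IH[OF xs] by simp
  qed
  then have "prod_list (map nc_gen (i # xs)) = (if ?l (perm_of (i # xs)) = length (i # xs)
    then nc_T (perm_of (i # xs)) else 0 :: ('k, 'n) nilcoxeter)"
    by simp
  then show ?case .
qed

lemma nc_T_mult:
  assumes w: "w permutes {1..CARD('n)}" and v: "v permutes {1..CARD('n)}"
  shows "nc_T w * nc_T v =
    (if cox_length CARD('n) (w \<circ> v) = cox_length CARD('n) w + cox_length CARD('n) v
     then nc_T (w \<circ> v) else 0 :: ('k::field, 'n::finite) nilcoxeter)"
proof -
  obtain xs ys where xs: "reduced_expr CARD('n) xs w" and ys: "reduced_expr CARD('n) ys v"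
    using reduced_expr_exists w v by meson
  have "nc_T w * nc_T v = (prod_list (map nc_gen (xs @ ys)) :: ('k, 'n) nilcoxeter)"
    by (simp add: prod_nc_gen_reduced_expr[OF xs] prod_nc_gen_reduced_expr[OF ys])
  also have "\<dots> = (if cox_length CARD('n) (w \<circ> v) = cox_length CARD('n) w + cox_length CARD('n) v
     then nc_T (w \<circ> v) else 0)"
    using xs ys by (subst prod_nc_gen) (auto simp: reduced_expr_def expresses_def perm_of_append)
  finally show ?thesis .
qed

subsection \<open>Coefficients\<close>

text \<open>
  The action \<open>T\<^sub>i T\<^sub>w = T\<^bsub>s\<^sub>i w\<^esub>\<close> or \<open>0\<close> of the generators on the basis, with \<open>w\<close> recorded as
  \<open>q = w\<inverse>\<close> and \<open>None\<close> for zero. In this form the relations hold for arbitrary functions \<open>q\<close>.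
\<close>

definition gen_step :: "nat \<Rightarrow> (nat \<Rightarrow> nat) option \<Rightarrow> (nat \<Rightarrow> nat) option" where
  "gen_step i x = Option.bind x (\<lambda>q. if q i < q (Suc i) then Some (q \<circ> adj i) else None)"

text \<open>Letting the word act on \<open>T_id = 1\<close> gives the coefficient of
  \<open>T_w\<close>; the target is \<open>inv w\<close> because the states are inverses.\<close>

definition word_coeff :: "(nat \<Rightarrow> nat) \<Rightarrow> 'n::finite gen_word \<Rightarrow> 'k::field" where
  "word_coeff w u = of_bool (foldr gen_step (Rep_gen_word u) (Some id) = Some (inv w))"

definition free_coeff :: "(nat \<Rightarrow> nat) \<Rightarrow> ('k::field, 'n::finite) free_alg \<Rightarrow> 'k" where
  "free_coeff w p = (\<Sum>u\<in>Poly_Mapping.keys p. Poly_Mapping.lookup p u * word_coeff w u)"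

lemma gen_step_square: "gen_step i (gen_step i x) = None"
  by (cases x) (auto simp: gen_step_def)

lemma gen_step_commute:
  "\<bar>int i - int j\<bar> > 1 \<Longrightarrow> gen_step i (gen_step j x) = gen_step j (gen_step i x)"
  by (cases x) (auto simp: gen_step_def fun_eq_iff transpose_def)

text \<open>If \<open>q\<close> has values \<open>a\<close>, \<open>b\<close>, \<open>c\<close> at
  \<open>i\<close>, \<open>i + 1\<close>, \<open>i + 2\<close>, either side survives exactly if
  \<open>a < b < c\<close>, and then reverses the three values.\<close>

lemma gen_step_braid:
  "gen_step i (gen_step (Suc i) (gen_step i x)) =
    gen_step (Suc i) (gen_step i (gen_step (Suc i) x))"
  by (cases x) (auto simp: gen_step_def fun_eq_iff transpose_def)

lemma foldr_gen_step_None: "foldr gen_step xs None = None"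
  by (induction xs) (simp_all add: gen_step_def)

lemma Rep_gen_word_single:
  "i \<in> {1..<CARD('n)} \<Longrightarrow> Rep_gen_word (Abs_gen_word [i] :: 'n::finite gen_word) = [i]"
  by (rule Abs_gen_word_inverse) simp

lemma free_coeff_zero [simp]: "free_coeff w 0 = 0"
  by (simp add: free_coeff_def)

lemma free_coeff_single [simp]: "free_coeff w (Poly_Mapping.single u c) = c * word_coeff w u"
  by (simp add: free_coeff_def)

lemma free_coeff_add: "free_coeff w (p + q) = free_coeff w p + free_coeff w q"
  unfolding free_coeff_def
  by (rule setsum_keys_plus_distrib[of "\<lambda>u c. c * word_coeff w u"])
    (simp_all add: distrib_right)

lemma free_coeff_diff: "free_coeff w (p - q) = free_coeff w p - free_coeff w q"
  using free_coeff_add[of w "p - q" q] by simp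

text \<open>By linearity in \<open>a\<close> and \<open>b\<close> it suffices to compare the two
  monomials between arbitrary words, where the claim becomes an identity of
  \<open>gen_step\<close>.\<close>

lemma free_coeff_sandwich_cong:
  assumes "\<And>k l. word_coeff w (k + u + l) = (word_coeff w (k + v + l) :: 'k::field)"
  shows "free_coeff w (a * Poly_Mapping.single u 1 * b) =
    free_coeff w (a * Poly_Mapping.single v (1 :: 'k) * b)"
proof (induction a rule: free_alg_induct)
  case (add a k c)
  have "free_coeff w (Poly_Mapping.single k c * Poly_Mapping.single u 1 * b) =
    free_coeff w (Poly_Mapping.single k c * Poly_Mapping.single v 1 * b)"
    by (induction b rule: free_alg_induct)
      (simp_all add: distrib_left free_coeff_add mult_single assms)
  with add show ?case by (simp add: distrib_right free_coeff_add)
qed simp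

lemma free_coeff_sandwich_zero:
  assumes "\<And>k l. word_coeff w (k + u + l) = (0 :: 'k::field)"
  shows "free_coeff w (a * Poly_Mapping.single u (1 :: 'k) * b) = 0"
proof (induction a rule: free_alg_induct)
  case (add a k c)
  have "free_coeff w (Poly_Mapping.single k c * Poly_Mapping.single u 1 * b) = 0"
    by (induction b rule: free_alg_induct)
      (simp_all add: distrib_left free_coeff_add mult_single assms)
  with add show ?case by (simp add: distrib_right free_coeff_add)
qed simp

lemma free_coeff_sandwich_relator:
  assumes "r \<in> (nc_relators :: ('k::field, 'n::finite) free_alg set)"
  shows "free_coeff w (a * r * b) = 0"
  using assms
proof cases
  case (braid i)
  have i: "Rep_gen_word (Abs_gen_word [i] :: 'n gen_word) = [i]"
    "Rep_gen_word (Abs_gen_word [Suc i] :: 'n gen_word) = [Suc i]"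
    using braid(2,3) by (auto intro!: Rep_gen_word_single)
  let ?i = "Abs_gen_word [i] :: 'n gen_word" and ?j = "Abs_gen_word [Suc i] :: 'n gen_word"
  have "free_coeff w (a * Poly_Mapping.single (?i + ?j + ?i) 1 * b) =
    free_coeff w (a * Poly_Mapping.single (?j + ?i + ?j) (1 :: 'k) * b)"
    by (rule free_coeff_sandwich_cong)
      (simp add: word_coeff_def plus_gen_word.rep_eq i gen_step_braid)
  then show ?thesis
    unfolding braid(1)
    by (simp add: free_gen_def mult_single left_diff_distrib right_diff_distrib free_coeff_diff)
next
  case (commute i j)
  have ij: "Rep_gen_word (Abs_gen_word [i] :: 'n gen_word) = [i]"
    "Rep_gen_word (Abs_gen_word [j] :: 'n gen_word) = [j]"
    using commute(2,3) by (auto intro!: Rep_gen_word_single)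
  let ?i = "Abs_gen_word [i] :: 'n gen_word" and ?j = "Abs_gen_word [j] :: 'n gen_word"
  have "free_coeff w (a * Poly_Mapping.single (?i + ?j) 1 * b) =
    free_coeff w (a * Poly_Mapping.single (?j + ?i) (1 :: 'k) * b)"
    by (rule free_coeff_sandwich_cong)
      (simp add: word_coeff_def plus_gen_word.rep_eq ij gen_step_commute[OF commute(4)])
  then show ?thesis
    unfolding commute(1)
    by (simp add: free_gen_def mult_single left_diff_distrib right_diff_distrib free_coeff_diff)
next
  case (nil i)
  have i: "Rep_gen_word (Abs_gen_word [i] :: 'n gen_word) = [i]"
    using nil(2) by (rule Rep_gen_word_single)
  let ?i = "Abs_gen_word [i] :: 'n gen_word"
  \<comment> \<open>A repeated letter yields \<open>None\<close>, and the remaining letters preserve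
    it.\<close>
  have "free_coeff w (a * Poly_Mapping.single (?i + ?i) (1 :: 'k) * b) = 0"
    by (rule free_coeff_sandwich_zero)
      (simp add: word_coeff_def plus_gen_word.rep_eq i gen_step_square foldr_gen_step_None)
  then show ?thesis
    unfolding nil(1) by (simp add: free_gen_def mult_single power2_eq_square)
qed

lemma free_coeff_ideal:
  "x \<in> (nc_ideal :: ('k::field, 'n::finite) free_alg set) \<Longrightarrow> free_coeff w x = 0"
  by (induction rule: nc_ideal.induct) (simp_all add: free_coeff_add free_coeff_sandwich_relator)

lift_definition nc_coeff :: "(nat \<Rightarrow> nat) \<Rightarrow> ('k::field, 'n::finite) nilcoxeter \<Rightarrow> 'k"
  is free_coeff
  using free_coeff_ideal free_coeff_diff by (metis eq_iff_diff_eq_0)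

lemma nc_coeff_zero [simp]: "nc_coeff w 0 = 0"
  by transfer simp

lemma nc_coeff_add: "nc_coeff w (x + y) = nc_coeff w x + nc_coeff w y"
  by transfer (rule free_coeff_add)

lemma nc_coeff_diff: "nc_coeff w (x - y) = nc_coeff w x - nc_coeff w y"
  by transfer (rule free_coeff_diff)

lemma nc_coeff_scale: "nc_coeff w (nc_scale c x) = c * nc_coeff w x"
proof transfer
  show "free_coeff w (Poly_Mapping.single 0 c * p) = c * free_coeff w p"
    for w and c :: "'k::field" and p :: "('k, 'n::finite) free_alg"
    by (induction p rule: free_alg_induct)
      (simp_all add: distrib_left free_coeff_add mult_single)
qed

lemma nc_coeff_sum: "nc_coeff w (sum f A) = (\<Sum>a\<in>A. nc_coeff w (f a))"
  by (induction A rule: infinite_finite_induct) (simp_all add: nc_coeff_add)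

lemma prod_nc_gen_eq_abs:
  "set xs \<subseteq> {1..<CARD('n)} \<Longrightarrow> (prod_list (map nc_gen xs) :: ('k::field, 'n::finite) nilcoxeter) =
    abs_nilcoxeter (Poly_Mapping.single (Abs_gen_word xs) 1)"
proof (induction xs)
  case Nil
  then show ?case by (simp add: one_nilcoxeter_def single_one flip: zero_gen_word_def)
next
  case (Cons i xs)
  have "Abs_gen_word [i] + Abs_gen_word xs = (Abs_gen_word (i # xs) :: 'n gen_word)"
    using Cons.prems by (subst plus_gen_word.abs_eq) (auto simp: eq_onp_def)
  with Cons show ?case
    by (simp add: nc_gen.abs_eq times_nilcoxeter.abs_eq free_gen_def mult_single)
qed

text \<open>By \<open>reduced_expr_ConsD\<close> each letter, read from the right, meets an ascent,
  so the state never becomes \<open>None\<close>.\<close>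

lemma foldr_gen_step_reduced_expr:
  "reduced_expr n xs w \<Longrightarrow> foldr gen_step xs (Some id) = Some (inv w)"
proof (induction xs arbitrary: w)
  case Nil
  then have "w = id" by (auto simp: reduced_expr_def expresses_def)
  then show ?case by simp
next
  case (Cons i xs)
  note i = reduced_expr_ConsD[OF Cons.prems]
  have "foldr gen_step xs (Some id) = Some (inv w \<circ> adj i)"
    using Cons.IH[OF i(2)] by (simp only: inv_adj_comp[OF reduced_expr_permutes[OF Cons.prems]])
  then have "foldr gen_step (i # xs) (Some id) = Some (inv w)"
    using i(3) by (simp add: gen_step_def comp_assoc)
  then show ?case .
qed

text \<open>The coordinate functionals are dual to the \<open>nc_T\<close>; this is where linear
  independence comes from.\<close>

lemma nc_coeff_T:
  assumes w: "w permutes {1..CARD('n)}" and v: "v permutes {1..CARD('n)}"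
  shows "nc_coeff w (nc_T v :: ('k::field, 'n::finite) nilcoxeter) = of_bool (w = v)"
proof -
  obtain xs where xs: "reduced_expr CARD('n) xs v" using reduced_expr_exists[OF v] by blast
  then have set: "set xs \<subseteq> {1..<CARD('n)}" by (simp add: reduced_expr_def expresses_def)
  have "nc_coeff w (nc_T v :: ('k, 'n) nilcoxeter) = word_coeff w (Abs_gen_word xs :: 'n gen_word)"
    by (simp add: prod_nc_gen_eq_abs[OF set] nc_coeff.abs_eq flip: prod_nc_gen_reduced_expr[OF xs])
  also have "\<dots> = of_bool (inv v = inv w)"
    using set by (simp add: word_coeff_def Abs_gen_word_inverse foldr_gen_step_reduced_expr[OF xs])
  also have "inv v = inv w \<longleftrightarrow> w = v"
    using permutes_inv_inv[OF v] permutes_inv_inv[OF w] by metis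
  finally show ?thesis .
qed

text \<open>Every monomial is a basis element or zero, so the \<open>nc_T\<close> span. In this
  form, linear claims need checking only on basis elements.\<close>

lemma nc_T_induct [case_names zero add]:
  fixes P :: "('k::field, 'n::finite) nilcoxeter \<Rightarrow> bool"
  assumes zero: "P 0"
    and add: "\<And>x c w. P x \<Longrightarrow> w permutes {1..CARD('n)} \<Longrightarrow> P (x + nc_scale c (nc_T w))"
  shows "P x"
proof -
  have "P (abs_nilcoxeter p)" for p
  proof (induction p rule: free_alg_induct)
    case zero
    show ?case using assms(1) by (simp add: zero_nilcoxeter_def)
  next
    case (add p u c)
    let ?xs = "Rep_gen_word u"
    have xs: "set ?xs \<subseteq> {1..<CARD('n)}" using Rep_gen_word[of u] by simp
    have "abs_nilcoxeter (p + Poly_Mapping.single u c) =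
        abs_nilcoxeter p + nc_scale c (prod_list (map nc_gen ?xs))"
      by (simp add: prod_nc_gen_eq_abs[OF xs] Rep_gen_word_inverse plus_nilcoxeter.abs_eq
          nc_scale.abs_eq mult_single)
    \<comment> \<open>A non-reduced word contributes zero; then the induction hypothesis alone
      suffices.\<close>
    then show ?case
      using assms(2)[OF add perm_of_permutes[OF xs]] add
      by (simp add: prod_nc_gen[OF xs])
  qed
  then show ?thesis by (rule nilcoxeter.abs_induct)
qed

lemma nc_T_expansion:
  "x = (\<Sum>w | w permutes {1..CARD('n)}. nc_scale (nc_coeff w x) (nc_T w))"
  for x :: "('k::field, 'n::finite) nilcoxeter"
proof (induction x rule: nc_T_induct)
  case zero
  show ?case by simp
next
  case (add x c v)
  let ?S = "{w. w permutes {1..CARD('n)}}"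
  have fin: "finite ?S" by (rule finite_permutations) simp
  have "(\<Sum>w\<in>?S. nc_scale (nc_coeff w (x + nc_scale c (nc_T v))) (nc_T w)) =
      (\<Sum>w\<in>?S. nc_scale (nc_coeff w x) (nc_T w)) +
      (\<Sum>w\<in>?S. if w = v then nc_scale c (nc_T v :: ('k, 'n) nilcoxeter) else 0)"
    unfolding sum.distrib[symmetric] using add(2)
    by (intro sum.cong) (auto simp: nc_coeff_add nc_coeff_scale nc_coeff_T nc.scale_left_distrib)
  also have "\<dots> = x + nc_scale c (nc_T v)"
    using add(2) fin unfolding add(1)[symmetric] by simp
  finally show ?case by (rule sym)
qed

lemma nc_eqI:
  assumes "\<And>w. w permutes {1..CARD('n)} \<Longrightarrow> nc_coeff w x = nc_coeff w y"
  shows "x = (y :: ('k::field, 'n::finite) nilcoxeter)"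
  by (subst nc_T_expansion[of x], subst nc_T_expansion[of y]) (use assms in simp)

section \<open>The twisted trace form\<close>

lemma nc_T_adj: "i \<in> {1..<CARD('n)} \<Longrightarrow> nc_T (adj i) = (nc_gen i :: ('k::field, 'n::finite) nilcoxeter)"
  using nc_gen_mult_T[OF permutes_id, of i, where 'k = 'k and 'n = 'n] by (simp add: nc_T_id)

lemma cox_length_complement:
  assumes "w permutes {1..n}"
  shows "cox_length n w + cox_length n (inv w \<circ> reversal n) = cox_length n (reversal n)"
  using cox_length_comp_reversal[OF permutes_inv[OF assms]] cox_length_inv[OF assms] by simp

lemma complement_permutes: "w permutes {1..n} \<Longrightarrow> inv w \<circ> reversal n permutes {1..n}"
  by (rule permutes_compose[OF reversal_permutes permutes_inv])

lemma comp_eq_reversal_iff: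
  assumes "w permutes {1..n}"
  shows "w \<circ> v = reversal n \<longleftrightarrow> v = inv w \<circ> reversal n"
  using permutes_inv_o[OF assms] by (metis comp_assoc id_comp)

text \<open>The complement is the only \<open>v\<close> for which \<open>w \<circ> v\<close> is the
  reversal, and there the lengths add up by \<open>cox_length_complement\<close>, so the product
  does not vanish.\<close>

lemma nc_T_mult_complement:
  assumes w: "w permutes {1..CARD('n)}" and v: "v permutes {1..CARD('n)}"
  shows "(nc_T w * nc_T v :: ('k::field, 'n::finite) nilcoxeter) = nc_T (reversal CARD('n))
      \<longleftrightarrow> v = inv w \<circ> reversal CARD('n)"
    and "nc_coeff (reversal CARD('n)) (nc_T w * nc_T v :: ('k, 'n) nilcoxeter) =
      of_bool (v = inv w \<circ> reversal CARD('n))"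
proof -
  let ?r = "reversal CARD('n)"
  have wv: "w \<circ> v permutes {1..CARD('n)}" by (rule permutes_compose[OF v w])
  have prod: "nc_T w * nc_T v = (nc_T ?r :: ('k, 'n) nilcoxeter)" if "v = inv w \<circ> ?r"
  proof -
    have "w \<circ> v = ?r" using that comp_eq_reversal_iff[OF w] by blast
    then show ?thesis
      using cox_length_complement[OF w, folded that] by (simp add: nc_T_mult[OF w v])
  qed
  have coeff: "nc_coeff ?r (nc_T w * nc_T v :: ('k, 'n) nilcoxeter) = 0" if "v \<noteq> inv w \<circ> ?r"
    using that comp_eq_reversal_iff[OF w, of v]
    by (auto simp: nc_T_mult[OF w v] nc_coeff_T[OF reversal_permutes wv])
  have one: "nc_coeff ?r (nc_T ?r :: ('k, 'n) nilcoxeter) = 1"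
    by (simp add: nc_coeff_T[OF reversal_permutes reversal_permutes])
  show "(nc_T w * nc_T v :: ('k, 'n) nilcoxeter) = nc_T ?r \<longleftrightarrow> v = inv w \<circ> ?r"
    using prod coeff one by (metis zero_neq_one)
  show "nc_coeff ?r (nc_T w * nc_T v :: ('k, 'n) nilcoxeter) = of_bool (v = inv w \<circ> ?r)"
    using prod coeff one by (cases "v = inv w \<circ> ?r") simp_all
qed

lemma nc_scale_mult_left: "nc_scale c x * y = nc_scale c (x * y)"
  by transfer (simp add: mult.assoc nc_ideal.zero)

lemma nc_scale_mult_right: "x * nc_scale c y = nc_scale c (x * (y :: ('k::field, 'n::finite) nilcoxeter))"
proof transfer
  fix p q :: "('k, 'n) free_alg" and c :: 'k
  have "p * Poly_Mapping.single 0 c = Poly_Mapping.single 0 c * p"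
    by (induction p rule: free_alg_induct)
      (simp_all add: distrib_left distrib_right mult_single mult.commute)
  then show "p * (Poly_Mapping.single 0 c * q) - Poly_Mapping.single 0 c * (p * q) \<in> nc_ideal"
    by (simp add: nc_ideal.zero flip: mult.assoc)
qed

lemma nc_flip_zero [simp]: "nc_flip 0 = 0"
  using nc_flip_add[of 0 0] by simp

lemma nc_coeff_reversal_T_mult:
  assumes w: "w permutes {1..CARD('n)}"
  shows "nc_coeff (reversal CARD('n)) (nc_T w * x :: ('k::field, 'n::finite) nilcoxeter) =
    nc_coeff (inv w \<circ> reversal CARD('n)) x"
proof -
  define u where "u = inv w \<circ> reversal CARD('n)"
  have u: "u permutes {1..CARD('n)}" unfolding u_def by (rule complement_permutes[OF w])
  have "nc_coeff (reversal CARD('n)) (nc_T w * x) = nc_coeff u x"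
  proof (induction x rule: nc_T_induct)
    case (add x c v)
    then show ?case
      using nc_T_mult_complement(2)[OF w add(2), where 'k = 'k, folded u_def]
        nc_coeff_T[OF u add(2), where 'k = 'k]
      by (auto simp: distrib_left nc_coeff_add nc_coeff_scale nc_scale_mult_right)
  qed simp
  then show ?thesis unfolding u_def .
qed

text \<open>Pairing with \<open>T_w\<close> reads the coordinate at the complement of
  \<open>w\<close>, and every permutation is such a complement.\<close>

lemma reversal_form_nondegenerate:
  assumes "\<And>b. nc_coeff (reversal CARD('n)) (b * x) = nc_coeff (reversal CARD('n)) (b * y)"
  shows "x = (y :: ('k::field, 'n::finite) nilcoxeter)"
proof (rule nc_eqI)
  fix v :: "nat \<Rightarrow> nat"
  let ?r = "reversal CARD('n)"
  assume v: "v permutes {1..CARD('n)}"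
  \<comment> \<open>Chosen so that its complement is \<open>v\<close>.\<close>
  let ?w = "?r \<circ> inv v"
  have w: "?w permutes {1..CARD('n)}"
    by (rule permutes_compose[OF permutes_inv[OF v] reversal_permutes])
  have "inv ?w = v \<circ> ?r"
    using o_inv_distrib[OF permutes_bij[OF reversal_permutes, of "CARD('n)"]
        permutes_bij[OF permutes_inv[OF v]]] permutes_inv_inv[OF v] by simp
  then have "inv ?w \<circ> ?r = v" by (simp add: comp_assoc)
  then show "nc_coeff v x = nc_coeff v y"
    using assms[of "nc_T ?w"] by (simp add: nc_coeff_reversal_T_mult[OF w])
qed

text \<open>Since \<open>nc_flip\<close> is multiplicative, the letters of a word \<open>a\<close>
  can be carried to the other side of \<open>b\<close> one at a time; linearity does the
  rest.\<close>

lemma twisted_trace: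
  fixes \<phi> :: "('k::field, 'n::finite) nilcoxeter \<Rightarrow> 'k"
  assumes add: "\<And>x y. \<phi> (x + y) = \<phi> x + \<phi> y" and scale: "\<And>c x. \<phi> (nc_scale c x) = c * \<phi> x"
    and gen: "\<And>i w. i \<in> {1..<CARD('n)} \<Longrightarrow> w permutes {1..CARD('n)} \<Longrightarrow>
      \<phi> (nc_gen i * nc_T w) = \<phi> (nc_T w * nc_gen (CARD('n) - i))"
  shows "\<phi> (a * b) = \<phi> (b * nc_flip a)"
proof -
  have zero: "\<phi> 0 = 0" using scale[of 0 0] by simp
  have gen': "\<phi> (nc_gen i * b) = \<phi> (b * nc_flip (nc_gen i))" if "i \<in> {1..<CARD('n)}" for i b
  proof (induction b rule: nc_T_induct)
    case (add x c w)
    then show ?case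
      using gen[OF that add(2)] that
      by (simp add: distrib_left distrib_right assms(1) scale nc_scale_mult_left
          nc_scale_mult_right nc_flip_gen)
  qed simp
  have word: "\<phi> (prod_list (map nc_gen xs) * b) = \<phi> (b * nc_flip (prod_list (map nc_gen xs)))"
    if "set xs \<subseteq> {1..<CARD('n)}" for xs b
    using that
  proof (induction xs arbitrary: b)
    case Nil
    show ?case by (simp add: nc_flip_one)
  next
    case (Cons i xs)
    let ?p = "prod_list (map nc_gen xs) :: ('k, 'n) nilcoxeter"
    \<comment> \<open>The first letter moves past \<open>?p * b\<close>, then \<open>?p\<close>
      moves past \<open>b\<close> together with that letter; hence \<open>b\<close> is arbitrary in
      the induction.\<close>
    have "\<phi> (nc_gen i * (?p * b)) = \<phi> (?p * b * nc_flip (nc_gen i))"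
      using Cons.prems by (intro gen') simp
    also have "\<dots> = \<phi> (b * nc_flip (nc_gen i) * nc_flip ?p)"
      using Cons.IH[of "b * nc_flip (nc_gen i)"] Cons.prems by (simp add: mult.assoc)
    finally show ?case by (simp add: nc_flip_mult mult.assoc)
  qed
  show ?thesis
  proof (induction a rule: nc_T_induct)
    case zero
    then show ?case by simp
  next
    case (add x c w)
    obtain xs where xs: "reduced_expr CARD('n) xs w" using reduced_expr_exists[OF add(2)] by blast
    then have "\<phi> (nc_T w * b) = \<phi> (b * nc_flip (nc_T w))"
      using word[of xs b]
      by (simp add: prod_nc_gen_reduced_expr[OF xs]) (simp add: reduced_expr_def expresses_def)
    with add show ?case
      by (simp add: distrib_left distrib_right assms(1) scale nc_scale_mult_left
          nc_scale_mult_right nc_flip_add nc_flip_scale)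
  qed
qed

lemma vanishes_on_twisted_commutators:
  fixes \<phi> :: "('k::field, 'n::finite) nilcoxeter \<Rightarrow> 'k"
  assumes add: "\<And>x y. \<phi> (x + y) = \<phi> x + \<phi> y" and scale: "\<And>c x. \<phi> (nc_scale c x) = c * \<phi> x"
    and twisted: "\<And>a b. \<phi> (a * b) = \<phi> (b * nc_flip a)"
    and x: "x \<in> twisted_commutators"
  shows "\<phi> x = 0"
proof (rule nc.span_induct[OF x[unfolded twisted_commutators_def], of "\<lambda>x. \<phi> x = 0"])
  have "\<phi> 0 = 0" using scale[of 0 0] by simp
  then show "nc.subspace {x. \<phi> x = 0}"
    by (auto simp: nc.subspace_def add scale)
  fix x :: "('k, 'n) nilcoxeter"
  assume "x \<in> {a * b - b * nc_flip a |a b. True}"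
  then obtain a b where x: "x = a * b - b * nc_flip a" by blast
  show "\<phi> x = 0"
    using add[of x "b * nc_flip a"] twisted[of a b] by (simp add: x)
qed

text \<open>On generators: \<open>T_i T_w\<close> reaches the longest element iff
  \<open>w = s_i w_0 = w_0 s_{n-i}\<close>, that is, iff \<open>w s_{n-i} = w_0\<close>.\<close>

lemma reversal_form_twisted:
  fixes a b :: "('k::field, 'n::finite) nilcoxeter"
  shows "nc_coeff (reversal CARD('n)) (a * b) = nc_coeff (reversal CARD('n)) (b * nc_flip a)"
proof (rule twisted_trace[OF nc_coeff_add nc_coeff_scale])
  fix i w
  let ?r = "reversal CARD('n)" and ?j = "CARD('n) - i"
  assume i: "i \<in> {1..<CARD('n)}" and w: "w permutes {1..CARD('n)}"
  have j: "?j \<in> {1..<CARD('n)}" using i by auto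
  note p = adj_permutes[OF i] adj_permutes[OF j]
  have "w = inv (adj i) \<circ> ?r \<longleftrightarrow> w = ?r \<circ> adj ?j"
    by (simp add: adj_comp_reversal[OF i])
  also have "\<dots> \<longleftrightarrow> w \<circ> adj ?j = ?r"
    by (metis comp_assoc comp_id transpose_comp_involutory)
  also have "\<dots> \<longleftrightarrow> adj ?j = inv w \<circ> ?r"
    by (rule comp_eq_reversal_iff[OF w])
  finally show "nc_coeff ?r (nc_gen i * nc_T w :: ('k, 'n) nilcoxeter) =
      nc_coeff ?r (nc_T w * nc_gen ?j :: ('k, 'n) nilcoxeter)"
    using nc_T_mult_complement(2)[OF p(1) w, where 'k = 'k]
      nc_T_mult_complement(2)[OF w p(2), where 'k = 'k]
    by (simp add: nc_T_adj[OF i] nc_T_adj[OF j])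
qed

text \<open>Twisted symmetry gives \<open>t(abz) = t(bz f(a))\<close>; by nondegeneracy this agrees
  with \<open>t(b f(a) z)\<close> for all \<open>a\<close>, \<open>b\<close> exactly if
  \<open>z\<close> commutes with everything.\<close>

lemma nc_center_iff:
  fixes z :: "('k::field, 'n::finite) nilcoxeter"
  shows "z \<in> nc_center \<longleftrightarrow> (\<forall>x\<in>twisted_commutators. nc_coeff (reversal CARD('n)) (x * z) = 0)"
    (is "_ \<longleftrightarrow> (\<forall>x\<in>_. ?t (x * z) = 0)")
proof
  assume z: "z \<in> nc_center"
  have comm: "z * x = x * z" for x using z by (simp add: nc_center_def)
  show "\<forall>x\<in>twisted_commutators. ?t (x * z) = 0"
  proof
    fix x :: "('k, 'n) nilcoxeter"
    assume x: "x \<in> twisted_commutators"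
    show "?t (x * z) = 0"
    proof (rule vanishes_on_twisted_commutators[OF _ _ _ x, where \<phi> = "\<lambda>x. ?t (x * z)"])
      fix a b :: "('k, 'n) nilcoxeter"
      have "?t (a * b * z) = ?t (b * z * nc_flip a)"
        using reversal_form_twisted[of a "b * z"] by (simp add: mult.assoc)
      then show "?t (a * b * z) = ?t (b * nc_flip a * z)"
        using comm[of "nc_flip a"] by (simp add: mult.assoc)
    qed (simp_all add: distrib_right nc_coeff_add nc_scale_mult_left nc_coeff_scale)
  qed
next
  assume van: "\<forall>x\<in>twisted_commutators. ?t (x * z) = 0"
  have "z * a = a * z" for a
  proof (rule reversal_form_nondegenerate)
    fix b :: "('k, 'n) nilcoxeter"
    \<comment> \<open>The first entry is \<open>nc_flip a\<close>, so that the twist turns it back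
      into \<open>a\<close>.\<close>
    have "nc_flip a * b - b * nc_flip (nc_flip a) \<in> twisted_commutators"
      unfolding twisted_commutators_def by (rule nc.span_base) blast
    then have "?t ((nc_flip a * b - b * a) * z) = 0"
      using van by (simp add: nc_flip_flip)
    then have "?t (nc_flip a * (b * z)) = ?t (b * (a * z))"
      by (simp add: left_diff_distrib nc_coeff_diff mult.assoc)
    then show "?t (b * (z * a)) = ?t (b * (a * z))"
      using reversal_form_twisted[of "nc_flip a" "b * z"] by (simp add: nc_flip_flip mult.assoc)
  qed
  then show "z \<in> nc_center" by (simp add: nc_center_def)
qed

section \<open>Functionals on the twisted cocenter\<close>

definition nc_functional :: "((nat \<Rightarrow> nat) \<Rightarrow> 'k) \<Rightarrow> ('k::field, 'n::finite) nilcoxeter \<Rightarrow> 'k" where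
  "nc_functional \<psi> x = (\<Sum>w | w permutes {1..CARD('n)}. nc_coeff w x * \<psi> w)"

lemma nc_functional_add: "nc_functional \<psi> (x + y) = nc_functional \<psi> x + nc_functional \<psi> y"
  by (simp add: nc_functional_def nc_coeff_add distrib_right sum.distrib)

lemma nc_functional_scale: "nc_functional \<psi> (nc_scale c x) = c * nc_functional \<psi> x"
  by (simp add: nc_functional_def nc_coeff_scale sum_distrib_left mult.assoc)

lemma nc_functional_T:
  assumes v: "v permutes {1..CARD('n)}"
  shows "nc_functional \<psi> (nc_T v :: ('k::field, 'n::finite) nilcoxeter) = \<psi> v"
proof -
  have "nc_functional \<psi> (nc_T v :: ('k, 'n) nilcoxeter) =
      (\<Sum>w | w permutes {1..CARD('n)}. if w = v then \<psi> v else 0)"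
    unfolding nc_functional_def
    by (rule sum.cong) (auto simp: nc_coeff_T[OF _ v])
  then show ?thesis using v by (simp add: finite_permutations)
qed

lemma twisted_proj_eq_iff:
  "twisted_proj x = twisted_proj y \<longleftrightarrow> x - y \<in> (twisted_commutators :: ('k::field, 'n::finite) nilcoxeter set)"
proof
  assume "twisted_proj x = twisted_proj y"
  moreover have "x \<in> twisted_proj x"
    by (simp add: twisted_proj_def twisted_commutators_def nc.span_zero)
  ultimately show "x - y \<in> twisted_commutators" by (simp add: twisted_proj_def)
next
  assume xy: "x - y \<in> twisted_commutators"
  have "u - x \<in> twisted_commutators \<longleftrightarrow> u - y \<in> twisted_commutators" for u
    using nc.span_add[OF _ xy[unfolded twisted_commutators_def], of "u - x"]
      nc.span_diff[OF _ xy[unfolded twisted_commutators_def], of "u - y"]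
    by (auto simp: twisted_commutators_def)
  then show "twisted_proj x = twisted_proj y" by (simp add: twisted_proj_def)
qed

text \<open>
  \<open>T\<^sub>i T\<^sub>w\<close> and \<open>T\<^sub>w T\<^bsub>n-i\<^esub>\<close> are congruent, and each is \<open>0\<close> or a basis element of degree \<open>l(w) + 1\<close>.
\<close>

lemma class_functional_vanishes:
  fixes \<psi> :: "(nat \<Rightarrow> nat) \<Rightarrow> 'k::field"
  assumes zero: "\<And>u. u permutes {1..CARD('n)} \<Longrightarrow>
      twisted_proj (nc_T u) = twisted_proj (0 :: ('k, 'n::finite) nilcoxeter) \<Longrightarrow> \<psi> u = 0"
    and cong: "\<And>u v. u permutes {1..CARD('n)} \<Longrightarrow> v permutes {1..CARD('n)} \<Longrightarrow>
      twisted_proj (nc_T u) = twisted_proj (nc_T v :: ('k, 'n) nilcoxeter) \<Longrightarrow>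
      cox_length CARD('n) u = cox_length CARD('n) v \<Longrightarrow> \<psi> u = \<psi> v"
    and x: "x \<in> (twisted_commutators :: ('k, 'n) nilcoxeter set)"
  shows "nc_functional \<psi> x = 0"
proof (rule vanishes_on_twisted_commutators[OF nc_functional_add nc_functional_scale _ x],
    rule twisted_trace[OF nc_functional_add nc_functional_scale])
  fix i w
  let ?j = "CARD('n) - i"
  assume i: "i \<in> {1..<CARD('n)}" and w: "w permutes {1..CARD('n)}"
  have j: "?j \<in> {1..<CARD('n)}" using i by auto
  have len: "cox_length CARD('n) (adj k) = 1" if "k \<in> {1..<CARD('n)}" for k
    using cox_length_adj_comp(1)[OF permutes_id that] by simp
  let ?P = "nc_gen i * nc_T w :: ('k, 'n) nilcoxeter"
  let ?Q = "nc_T w * nc_gen ?j :: ('k, 'n) nilcoxeter"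
  have P: "?P = 0 \<or> (\<exists>u. u permutes {1..CARD('n)} \<and> ?P = nc_T u \<and>
      cox_length CARD('n) u = Suc (cox_length CARD('n) w))"
    using nc_T_mult[OF adj_permutes[OF i] w, where 'k = 'k] permutes_compose[OF w adj_permutes[OF i]]
    by (auto simp: nc_T_adj[OF i] len[OF i] split: if_splits)
  have Q: "?Q = 0 \<or> (\<exists>u. u permutes {1..CARD('n)} \<and> ?Q = nc_T u \<and>
      cox_length CARD('n) u = Suc (cox_length CARD('n) w))"
    using nc_T_mult[OF w adj_permutes[OF j], where 'k = 'k] permutes_compose[OF adj_permutes[OF j] w]
    by (auto simp: nc_T_adj[OF j] len[OF j] split: if_splits)
  have "?P - nc_T w * nc_flip (nc_gen i) \<in> twisted_commutators"
    unfolding twisted_commutators_def by (rule nc.span_base) blast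
  then have PQ: "twisted_proj ?P = twisted_proj ?Q"
    by (simp add: nc_flip_gen[OF i] twisted_proj_eq_iff)
  have z: "nc_functional \<psi> (0 :: ('k, 'n) nilcoxeter) = 0"
    by (simp add: nc_functional_def)
  \<comment> \<open>If exactly one product vanishes, the other is a basis element in the class of
    zero and \<open>zero\<close> applies; if neither does, both are basis elements of the same
    length and \<open>cong\<close> applies.\<close>
  from P show "nc_functional \<psi> ?P = nc_functional \<psi> ?Q"
  proof (elim disjE exE conjE)
    assume P0: "?P = 0"
    from Q show ?thesis
    proof (elim disjE exE conjE)
      fix v assume "v permutes {1..CARD('n)}" "?Q = nc_T v"
      then show ?thesis using zero[of v] PQ P0 by (simp add: nc_functional_T z)
    qed (simp add: P0)
  next
    fix u assume u: "u permutes {1..CARD('n)}" "?P = nc_T u"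
      "cox_length CARD('n) u = Suc (cox_length CARD('n) w)"
    from Q show ?thesis
    proof (elim disjE exE conjE)
      fix v assume "v permutes {1..CARD('n)}" "?Q = nc_T v"
        "cox_length CARD('n) v = Suc (cox_length CARD('n) w)"
      then show ?thesis using cong[of u v] PQ u by (simp add: nc_functional_T)
    next
      assume "?Q = 0"
      then show ?thesis using zero[of u] PQ u by (simp add: nc_functional_T z)
    qed
  qed
qed

section \<open>The homogeneous basis of the center\<close>

theorem mainTheorem3:
  fixes n :: nat
    and w0 :: "nat \<Rightarrow> nat"
    and B :: "('k::field, 'n::finite) nilcoxeter set set"
    and z :: "('k, 'n) nilcoxeter set \<Rightarrow> ('k, 'n) nilcoxeter"
  assumes n: "n = CARD('n)"
    and w0: "w0 = longest_perm n"
    and B: "B = {twisted_proj (nc_T w) | w.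
      w permutes {1..n} \<and> twisted_proj (nc_T w :: ('k, 'n) nilcoxeter) \<noteq> twisted_proj 0}"
    and z: "\<And>c. c \<in> B \<Longrightarrow>
      z c = (\<Sum>w | w permutes {1..n} \<and> twisted_proj (nc_T w) = c. nc_T (inv w \<circ> w0))"
  shows "(\<forall>w v. w permutes {1..n} \<longrightarrow> v permutes {1..n} \<longrightarrow>
           ((nc_T w * nc_T v :: ('k, 'n) nilcoxeter) = nc_T w0 \<longleftrightarrow> v = inv w \<circ> w0))
       \<and> inj_on z B \<and> nc.independent (z ` B) \<and> nc.span (z ` B) = nc_center
       \<and> (\<forall>c\<in>B. \<exists>d. z c \<in> nc_graded_part d)"
proof -
  let ?S = "{w. w permutes {1..n}}" and ?T = "nc_T :: _ \<Rightarrow> ('k, 'n) nilcoxeter"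
  let ?\<pi> = "\<lambda>w. twisted_proj (?T w)"
  have r: "w0 = reversal CARD('n)" by (simp add: w0 n longest_perm_eq_reversal)
  have finS: "finite ?S" by (rule finite_permutations) simp
  have "B \<subseteq> ?\<pi> ` ?S" by (auto simp: B)
  then have finB: "finite B" using finS by (rule finite_surj[rotated])
  have BE: "\<exists>w. w permutes {1..n} \<and> c = ?\<pi> w \<and> c \<noteq> twisted_proj 0" if "c \<in> B" for c
    using that by (auto simp: B)
  define rep where "rep c = (SOME w. w permutes {1..n} \<and> c = ?\<pi> w)" for c
  have rep: "rep c permutes {1..n}" "?\<pi> (rep c) = c" if "c \<in> B" for c
    using someI_ex[of "\<lambda>w. w permutes {1..n} \<and> c = ?\<pi> w"] BE[OF that]
    unfolding rep_def by metis+

  \<comment> \<open>The summand complementary to \<open>?T v\<close> is present in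
    \<open>z c\<close> exactly if \<open>v\<close> lies in the class \<open>c\<close>.\<close>
  have dual: "nc_coeff w0 (?T v * z c) = of_bool (?\<pi> v = c)"
    if v: "v permutes {1..n}" and c: "c \<in> B" for v c
  proof -
    have inj: "inv v \<circ> w0 = inv w \<circ> w0 \<longleftrightarrow> w = v" if w: "w permutes {1..n}" for w
    proof
      assume "inv v \<circ> w0 = inv w \<circ> w0"
      then have "(inv v \<circ> w0) \<circ> w0 = (inv w \<circ> w0) \<circ> w0" by simp
      then have "inv v = inv w" by (simp add: r comp_assoc)
      then show "w = v" using permutes_inv_inv[OF v] permutes_inv_inv[OF w] by metis
    qed simp
    have "nc_coeff w0 (?T v * z c) = nc_coeff (inv v \<circ> w0) (z c)"
      using nc_coeff_reversal_T_mult v by (simp add: r n)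
    also have "\<dots> = (\<Sum>w | w permutes {1..n} \<and> ?\<pi> w = c. if w = v then 1 else 0)"
      unfolding z[OF c] nc_coeff_sum
    proof (rule sum.cong[OF refl])
      fix w assume "w \<in> {w. w permutes {1..n} \<and> ?\<pi> w = c}"
      then show "nc_coeff (inv v \<circ> w0) (?T (inv w \<circ> w0)) = (if w = v then 1 else 0)"
        using nc_coeff_T[OF complement_permutes complement_permutes, of v w, where 'k = 'k and 'n = 'n]
          v inj[of w] by (auto simp: r n)
    qed
    also have "\<dots> = of_bool (?\<pi> v = c)"
      using finS v by (subst sum.delta) auto
    finally show ?thesis .
  qed

  have eqI: "x = y" if "\<And>v. v permutes {1..n} \<Longrightarrow> nc_coeff w0 (?T v * x) = nc_coeff w0 (?T v * y)"
    for x y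
  proof (rule reversal_form_nondegenerate)
    show "nc_coeff (reversal CARD('n)) (b * x) = nc_coeff (reversal CARD('n)) (b * y)" for b
      by (induction b rule: nc_T_induct)
        (use that in \<open>simp_all add: distrib_right nc_coeff_add nc_scale_mult_left nc_coeff_scale r n\<close>)
  qed
  \<comment> \<open>Thus \<open>z c\<close> represents the indicator functional of its class under
    the trace form.\<close>
  have functional: "nc_coeff w0 (x * z c) = nc_functional (\<lambda>w. of_bool (?\<pi> w = c)) x"
    if c: "c \<in> B" for x c
    by (induction x rule: nc_T_induct)
      (use dual[OF _ c] in \<open>simp_all add: distrib_right nc_coeff_add nc_scale_mult_left
        nc_coeff_scale nc_functional_add nc_functional_scale nc_functional_T n nc_functional_def[of _ 0]\<close>)
  \<comment> \<open>Pairing a combination with \<open>?T v\<close> isolates the coefficient of the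
    class of \<open>v\<close>; nothing remains if that class is zero.\<close>
  have comb: "nc_coeff w0 (?T v * (\<Sum>c\<in>B. nc_scale (a c) (z c))) = (if ?\<pi> v \<in> B then a (?\<pi> v) else 0)"
    if v: "v permutes {1..n}" for v a
  proof -
    have "nc_coeff w0 (?T v * (\<Sum>c\<in>B. nc_scale (a c) (z c))) =
        (\<Sum>c\<in>B. if c = ?\<pi> v then a c else 0)"
      unfolding sum_distrib_left nc_coeff_sum
      by (rule sum.cong) (use dual[OF v] in \<open>auto simp: nc_scale_mult_right nc_coeff_scale\<close>)
    then show ?thesis using finB by simp
  qed

  have inj: "inj_on z B"
  proof (rule inj_onI)
    fix c c' assume c: "c \<in> B" and c': "c' \<in> B" and eq: "z c = z c'"
    have "of_bool (c = c) = (of_bool (c = c') :: 'k)"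
      using dual[OF rep(1)[OF c] c] dual[OF rep(1)[OF c] c'] rep(2)[OF c] eq by simp
    then show "c = c'" by (simp split: if_splits)
  qed

  have indep: "nc.independent (z ` B)"
  proof (rule nc.independent_if_scalars_zero)
    fix f x assume sum: "(\<Sum>x\<in>z ` B. nc_scale (f x) x) = 0" and "x \<in> z ` B"
    then obtain c where c: "c \<in> B" "x = z c" by blast
    have "(\<Sum>c\<in>B. nc_scale (f (z c)) (z c)) = 0"
      using sum by (simp add: sum.reindex[OF inj])
    then show "f x = 0"
      using comb[OF rep(1)[OF c(1)], of "f \<circ> z"] rep(2)[OF c(1)] c by simp
  qed (use finB in simp)

  have central: "z c \<in> nc_center" if c: "c \<in> B" for c
    unfolding nc_center_iff
  proof
    fix x :: "('k, 'n) nilcoxeter"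
    assume x: "x \<in> twisted_commutators"
    \<comment> \<open>The indicator of \<open>c\<close> is constant on classes, and it is 0 on the
      zero class because \<open>c\<close> is in \<open>B\<close>.\<close>
    have "nc_functional (\<lambda>w. of_bool (?\<pi> w = c)) x = 0"
      by (rule class_functional_vanishes[OF _ _ x]) (use BE[OF c] in auto)
    then show "nc_coeff (reversal CARD('n)) (x * z c) = 0"
      using functional[OF c, of x] by (simp add: r)
  qed

  have span: "nc.span (z ` B) = nc_center"
  proof
    have "nc.subspace (nc_center :: ('k, 'n) nilcoxeter set)"
      by (auto simp: nc.subspace_def nc_center_def distrib_left distrib_right
          nc_scale_mult_left nc_scale_mult_right)
    then show "nc.span (z ` B) \<subseteq> nc_center"
      using central by (intro nc.span_minimal) auto
    show "nc_center \<subseteq> nc.span (z ` B)"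
    proof
      fix x :: "('k, 'n) nilcoxeter"
      assume "x \<in> nc_center"
      then have van: "nc_coeff w0 (y * x) = 0" if "y \<in> twisted_commutators" for y
        using that by (simp add: nc_center_iff r)
      \<comment> \<open>The coefficient of \<open>z c\<close> is the value at a member of
        \<open>c\<close> of the functional represented by \<open>x\<close>; centrality makes it
        independent of the member.\<close>
      have "x = (\<Sum>c\<in>B. nc_scale (nc_coeff w0 (?T (rep c) * x)) (z c))"
      proof (rule eqI)
        fix v assume v: "v permutes {1..n}"
        show "nc_coeff w0 (?T v * x) =
            nc_coeff w0 (?T v * (\<Sum>c\<in>B. nc_scale (nc_coeff w0 (?T (rep c) * x)) (z c)))"
        proof (cases "?\<pi> v \<in> B")
          case True
          have "?T v - ?T (rep (?\<pi> v)) \<in> twisted_commutators"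
            using rep(2)[OF True] by (simp flip: twisted_proj_eq_iff)
          from van[OF this] show ?thesis
            by (simp add: comb[OF v] True left_diff_distrib nc_coeff_diff)
        next
          case False
          then have "?\<pi> v = twisted_proj 0" using v by (auto simp: B)
          then have "?T v \<in> twisted_commutators" by (simp add: twisted_proj_eq_iff)
          from van[OF this] show ?thesis by (simp add: comb[OF v] False)
        qed
      qed
      then show "x \<in> nc.span (z ` B)"
        by (metis (no_types, lifting) imageI nc.span_base nc.span_scale nc.span_sum)
    qed
  qed

  have graded: "\<exists>d. z c \<in> nc_graded_part d" if c: "c \<in> B" for c
  proof -
    let ?l = "cox_length n"
    have len: "?l w = ?l (rep c)" if w: "w permutes {1..n}" "?\<pi> w = c" for w
    proof -
      \<comment> \<open>The indicator of \<open>c\<close> cut down to one length still kills all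
        twisted commutators, since \<open>class_functional_vanishes\<close> compares only elements
        of equal length. It is 1 at \<open>rep c\<close>, hence also at \<open>w\<close>.\<close>
      let ?\<psi> = "\<lambda>w. of_bool (?\<pi> w = c \<and> ?l w = ?l (rep c)) :: 'k"
      have "?T w - ?T (rep c) \<in> twisted_commutators"
        using rep(2)[OF c] w(2) by (simp flip: twisted_proj_eq_iff)
      then have "nc_functional ?\<psi> (?T w - ?T (rep c)) = 0"
        by (rule class_functional_vanishes[rotated 2]) (use BE[OF c] in \<open>auto simp: n\<close>)
      then have "nc_functional ?\<psi> (?T w) = nc_functional ?\<psi> (?T (rep c))"
        using nc_functional_add[of ?\<psi> "?T w - ?T (rep c)" "?T (rep c)"] by simp
      then have "?\<psi> w = ?\<psi> (rep c)"
        using w(1) rep(1)[OF c] by (simp add: nc_functional_T n)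
      then show ?thesis using rep(2)[OF c] by (simp split: if_splits)
    qed
    \<comment> \<open>The truncated subtraction is exact, as complementary lengths sum to that of
      \<open>w0\<close>.\<close>
    have "z c \<in> nc_graded_part (?l w0 - ?l (rep c))"
      unfolding z[OF c] nc_graded_part_def
    proof (rule nc.span_sum, rule nc.span_base)
      fix w assume "w \<in> {w. w permutes {1..n} \<and> ?\<pi> w = c}"
      then have w: "w permutes {1..n}" and eq: "?l w = ?l (rep c)" using len by auto
      have "?l (inv w \<circ> w0) = ?l w0 - ?l (rep c)"
        using cox_length_complement[OF w] eq by (simp add: r n)
      then show "?T (inv w \<circ> w0) \<in> {nc_T w |w. w permutes {1..CARD('n)} \<and>
          cox_length CARD('n) w = ?l w0 - ?l (rep c)}"
        using complement_permutes[OF w] by (auto simp: r n)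
    qed
    then show ?thesis ..
  qed

  show ?thesis
    using nc_T_mult_complement(1)[where 'k = 'k and 'n = 'n] inj indep span graded by (simp add: r n)
qed

end
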